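(* There is an absolute constant $\kappa>0$ such that the following holds. Let $z_0\in\mathbb{C}$ and $r>0$, let $V:D(z_0,r)\to[0,+\infty)$ be a measurable function, and define $$c:=\inf_{z'\in D(z_0,r)\setminus D\left(z_0,\frac r2\right)}V(z').$$ If $f\in L^2(D(z_0,r))$ is such that $\frac{\partial f}{\partial\overline z}\in L^2(D(z_0,r))$, then $$\int_{D(z_0,r)}\left|\frac{\partial f}{\partial\overline z}\right|^2+\int_{D(z_0,r)}V|f|^2\geq\kappa\,\min\left\{c,\frac1{r^2}\right\}\int_{D(z_0,r)}|f|^2.$$
   Context: $D(z_0,r)$ denotes the disc in $\mathbb{C}$ of center $z_0$ and radius $r$. Integrals are with respect to Lebesgue measure, functions $f$ are complex-valued, and $\frac{\partial f}{\partial\overline z}$ is understood in the sense of distributions. The second integral on the left-hand side may be $+\infty$. *)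

theory Defs
  imports "HOL-Analysis.Analysis"
begin

definition L2_on :: "complex set \<Rightarrow> (complex \<Rightarrow> complex) \<Rightarrow> bool" where
  "L2_on S f \<longleftrightarrow> f \<in> borel_measurable (lebesgue_on S) \<and>
     integrable (lebesgue_on S) (\<lambda>z. (cmod (f z))\<^sup>2)"

(* Partial derivatives in the real and the imaginary direction; differentiability is over the reals. *)

definition partial_x :: "(complex \<Rightarrow> complex) \<Rightarrow> complex \<Rightarrow> complex" where
  "partial_x \<phi> z = frechet_derivative \<phi> (at z) 1"

definition partial_y :: "(complex \<Rightarrow> complex) \<Rightarrow> complex \<Rightarrow> complex" where
  "partial_y \<phi> z = frechet_derivative \<phi> (at z) \<i>"

primrec C_k :: "nat \<Rightarrow> (complex \<Rightarrow> complex) \<Rightarrow> bool" where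
  "C_k 0 \<phi> \<longleftrightarrow> continuous_on UNIV \<phi>"
| "C_k (Suc k) \<phi> \<longleftrightarrow> (\<forall>z. \<phi> differentiable (at z)) \<and> C_k k (partial_x \<phi>) \<and> C_k k (partial_y \<phi>)"

definition test_function :: "complex set \<Rightarrow> (complex \<Rightarrow> complex) \<Rightarrow> bool" where
  "test_function U \<phi> \<longleftrightarrow> (\<forall>k. C_k k \<phi>) \<and>
     compact (closure {z. \<phi> z \<noteq> 0}) \<and> closure {z. \<phi> z \<noteq> 0} \<subseteq> U"

definition dbar :: "(complex \<Rightarrow> complex) \<Rightarrow> complex \<Rightarrow> complex" where
  "dbar \<phi> z = (partial_x \<phi> z + \<i> * partial_y \<phi> z) / 2"

definition locally_integrable_on :: "complex set \<Rightarrow> (complex \<Rightarrow> complex) \<Rightarrow> bool" where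
  "locally_integrable_on U f \<longleftrightarrow> (\<forall>K. compact K \<and> K \<subseteq> U \<longrightarrow> integrable (lebesgue_on K) f)"

(* For U open: g represents the d-bar derivative of f on U in the sense of distributions.
   Local integrability ensures that both sides are integrals of integrable functions,
   as the Bochner integral of a non-integrable function is 0. *)

definition has_distributional_dbar ::
  "complex set \<Rightarrow> (complex \<Rightarrow> complex) \<Rightarrow> (complex \<Rightarrow> complex) \<Rightarrow> bool" where
  "has_distributional_dbar U f g \<longleftrightarrow>
     locally_integrable_on U f \<and> locally_integrable_on U g \<and>
     (\<forall>\<phi>. test_function U \<phi> \<longrightarrow>
        (LINT z|lebesgue_on U. g z * \<phi> z) = - (LINT z|lebesgue_on U. f z * dbar \<phi> z))"

end

theory Submission
  imports Defs "HOL-Real_Asymp.Real_Asymp"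
begin

text \<open>
  The point is to bound the norm of \<open>f\<close> on the disc by \<open>r\<close> times the norm of
  \<open>g = dbar f\<close> plus the norm of \<open>f\<close> on the annulus. Let \<open>\<chi>\<close> be a smooth cutoff,
  equal to 1 on the half disc and supported in the disc, and let \<open>h = \<chi> f\<close>. Then
  \<open>dbar h = \<chi> g + f dbar \<chi>\<close>, where the last term lives on the annulus, so it suffices
  to bound the norm of \<open>h\<close> by a multiple of \<open>r\<close> times the norm of \<open>dbar h\<close>.

  Place the disc in a square of side \<open>2r\<close> with the orthogonal functions
  \<open>exp (\<i>\<pi>((k + 1/2)x + ly)/r)\<close>. Testing with the product of \<open>\<chi>\<close> and such a
  function shows that \<open>dbar\<close> multiplies the coefficients of \<open>h\<close> by numbers which,
  thanks to the shift by 1/2, are at least \<open>\<pi>/(4r)\<close> in absolute value. Instead of Parseval's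
  identity for \<open>h\<close>, it is enough to pair \<open>h\<close> with trigonometric polynomials that
  converge boundedly to a truncation of the conjugate of \<open>h\<close>.
\<close>

section \<open>A smooth plateau function\<close>

text \<open>Follows the recursion of \<open>C_k\<close>, so that smoothness of products in separated
  variables becomes an induction on \<open>k\<close>. Values in an arbitrary normed field cover both
  the real bump functions and the complex exponentials.\<close>

primrec times_cont_diff :: "nat \<Rightarrow> (real \<Rightarrow> 'a::real_normed_field)
    \<Rightarrow> bool" where
  "times_cont_diff 0 f \<longleftrightarrow> continuous_on UNIV f"
| "times_cont_diff (Suc k) f \<longleftrightarrow>
     (\<exists>f'. (\<forall>x. (f has_vector_derivative f' x) (at x)) \<and> times_cont_diff k f')"

lemma times_cont_diff_SucI:
  "(\<And>x. (f has_vector_derivative f' x) (at x)) \<Longrightarrow> times_cont_diff k f'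
      \<Longrightarrow> times_cont_diff (Suc k) f"
  unfolding times_cont_diff.simps by blast

lemma times_cont_diff_continuous: "times_cont_diff k f \<Longrightarrow> continuous_on UNIV f"
  by (cases k) (auto intro!: continuous_at_imp_continuous_on dest!: spec intro:
      has_vector_derivative_continuous)

lemma times_cont_diff_Suc_D: "times_cont_diff (Suc k) f \<Longrightarrow> times_cont_diff k f"
proof (induction k arbitrary: f)
  case 0
  then show ?case using times_cont_diff_continuous by fastforce
next
  case (Suc k)
  from Suc.prems obtain f' where "\<forall>x. (f has_vector_derivative f' x) (at x)"
      "times_cont_diff (Suc k) f'"
    unfolding times_cont_diff.simps(2)[of "Suc k"] by blast
  with Suc.IH show ?case by auto
qed

lemma times_cont_diff_const: "times_cont_diff k (\<lambda>x. c)"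
  by (induction k arbitrary: c) (auto intro!: exI[of _ "\<lambda>x. 0"] derivative_eq_intros)

lemma times_cont_diff_add:
  "times_cont_diff k f \<Longrightarrow> times_cont_diff k g \<Longrightarrow> times_cont_diff k
      (\<lambda>x. f x + g x)"
proof (induction k arbitrary: f g)
  case (Suc k)
  then obtain f' g' where "\<forall>x. (f has_vector_derivative f' x) (at x)" "times_cont_diff k f'"
    "\<forall>x. (g has_vector_derivative g' x) (at x)" "times_cont_diff k g'" by auto
  then show ?case using Suc.IH
    by (auto intro!: exI[of _ "\<lambda>x. f' x + g' x"] derivative_intros)
qed (auto intro: continuous_intros)

lemma times_cont_diff_mult:
  "times_cont_diff k f \<Longrightarrow> times_cont_diff k g \<Longrightarrow> times_cont_diff k
      (\<lambda>x. f x * g x)"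
proof (induction k arbitrary: f g)
  case (Suc k)
  then obtain f' g' where *: "\<forall>x. (f has_vector_derivative f' x) (at x)" "times_cont_diff k f'"
    "\<forall>x. (g has_vector_derivative g' x) (at x)" "times_cont_diff k g'" by auto
  have "times_cont_diff k f" "times_cont_diff k g"
    using Suc.prems by (blast intro: times_cont_diff_Suc_D)+
  then have "times_cont_diff k (\<lambda>x. f x * g' x + f' x * g x)"
    using Suc.IH * by (intro times_cont_diff_add) auto
  then show ?case using *
    by (auto intro!: exI[of _ "\<lambda>x. f x * g' x + f' x * g x"] has_vector_derivative_mult)
qed (auto intro: continuous_intros)

text \<open>The derivative is spelled out as a product of a constant, \<open>f'\<close> and two
  inverses, so that the closure under constants and products applies to it in the induction for
  \<open>times_cont_diff_inverse\<close>.\<close>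

lemma has_vector_derivative_inverse:
  fixes f :: "real \<Rightarrow> 'a::real_normed_field"
  assumes "(f has_vector_derivative f') (at x)" "f x \<noteq> 0"
  shows "((\<lambda>x. inverse (f x)) has_vector_derivative (- 1 * f') * (inverse (f x) * inverse
      (f x))) (at x)"
  using Deriv.has_derivative_inverse[OF assms(2) assms(1)[unfolded has_vector_derivative_def]] 
  unfolding has_vector_derivative_def by (simp add: mult.commute mult.left_commute)

lemma times_cont_diff_inverse:
  assumes "\<And>x. f x \<noteq> 0"
  shows "times_cont_diff k f \<Longrightarrow> times_cont_diff k (\<lambda>x. inverse (f x))"
proof (induction k)
  case (Suc k)
  then obtain f' where *: "\<forall>x. (f has_vector_derivative f' x) (at x)" "times_cont_diff k f'" by auto
  have "times_cont_diff k f"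
    using Suc.prems by (blast intro: times_cont_diff_Suc_D)+
  then have "times_cont_diff k (\<lambda>x. (- 1 * f' x) * (inverse (f x) * inverse (f x)))"
    using Suc.IH * by (intro times_cont_diff_mult times_cont_diff_const) auto
  then show ?case using * assms
    by (auto intro!: exI[of _ "\<lambda>x. (- 1 * f' x) * (inverse (f x) * inverse (f x))"] 
      has_vector_derivative_inverse simp del: mult_minus_left mult_minus1)
qed (use assms in \<open>simp add: Limits.continuous_on_inverse\<close>)

lemma times_cont_diff_affine:
  "times_cont_diff k f \<Longrightarrow> times_cont_diff k (\<lambda>x. f (a * x + b))"
proof (induction k arbitrary: f)
  case 0
  then show ?case
    by (auto intro!: continuous_on_compose2[of UNIV f] continuous_intros)
next
  case (Suc k)
  then obtain f' where *: "\<forall>x. (f has_vector_derivative f' x) (at x)" "times_cont_diff k f'" by auto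
  have "((\<lambda>x. f (a * x + b)) has_vector_derivative of_real a * f' (a * x + b)) (at x)" for x
  proof -
    have "((\<lambda>x. a * x + b) has_vector_derivative a) (at x)"
      by (auto intro!: derivative_eq_intros simp: has_real_derivative_iff_has_vector_derivative[symmetric])
    from vector_diff_chain_at[OF this, of f "f' (a * x + b)"] *
    show ?thesis by (simp add: o_def scaleR_conv_of_real)
  qed
  moreover have "times_cont_diff k (\<lambda>x. of_real a * f' (a * x + b))"
    using Suc.IH * by (intro times_cont_diff_mult times_cont_diff_const) auto
  ultimately show ?case by (rule times_cont_diff_SucI)
qed

lemma times_cont_diff_of_real:
  "times_cont_diff k f \<Longrightarrow> times_cont_diff k (\<lambda>x. of_real (f x) ::
      'a::real_normed_field)"
proof (induction k arbitrary: f)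
  case (Suc k)
  then obtain f' where *: "\<forall>x. (f has_vector_derivative f' x) (at x)" "times_cont_diff k f'" by auto
  then show ?case using Suc.IH
    by (auto intro!: exI[of _ "\<lambda>x. of_real (f' x)"] has_vector_derivative_of_real
      simp: has_real_derivative_iff_has_vector_derivative)
qed (auto intro: continuous_intros)

lemma times_cont_diff_cis: "times_cont_diff k (\<lambda>x. cis (a * x))"
proof (induction k)
  case (Suc k)
  have "((\<lambda>x. cis (a * x)) has_vector_derivative (\<i> * of_real a) * cis (a * x)) (at x)" for x
    unfolding cis_conv_exp
    by (rule derivative_eq_intros has_vector_derivative_real_field refl | simp)+
  moreover have "times_cont_diff k (\<lambda>x. (\<i> * of_real a) * cis (a * x))"
    using Suc by (intro times_cont_diff_mult times_cont_diff_const)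
  ultimately show ?case by (rule times_cont_diff_SucI)
qed (auto intro!: continuous_intros)

section \<open>The smooth step built from exp(-1/t)\<close>

definition flat_exp :: "nat \<Rightarrow> real \<Rightarrow> real" where
  "flat_exp n t = (if t > 0 then exp (- 1 / t) / t ^ n else 0)"

lemma flat_exp_at_right_0: "((\<lambda>t. exp (- 1 / t) / t ^ n :: real) \<longlongrightarrow> 0)
    (at_right 0)"
  by real_asymp

text \<open>The powers \<open>t ^ n\<close> in the denominator make the family closed under
  differentiation up to linear combinations. Smoothness of every member then follows by one
  induction that keeps \<open>n\<close> arbitrary.\<close>

lemma flat_exp_has_derivative:
  "(flat_exp n has_real_derivative flat_exp (n + 2) x - of_nat n * flat_exp (n + 1) x) (at x)"
proof -
  consider "x < 0" | "x = 0" | "x > 0" by linarith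
  then show ?thesis
  proof cases
    case 1
    have "((\<lambda>_. 0) has_real_derivative 0) (at x)" by simp
    then have "(flat_exp n has_real_derivative 0) (at x)"
      by (rule has_field_derivative_transform_within_open[of _ _ _ "{..<0}"])
        (use 1 in \<open>auto simp: flat_exp_def\<close>)
    then show ?thesis using 1 by (simp add: flat_exp_def)
  next
    case 3
    have "((\<lambda>t. exp (- 1 / t) / t ^ n) has_real_derivative 
       (exp (- 1 / x) * (1 / x\<^sup>2) * x ^ n - exp (- 1 / x) * (real n * x ^ (n - 1))) / (x ^ n
           * x ^ n)) (at x)"
      using 3 by (auto intro!: derivative_eq_intros simp: power2_eq_square)
    then have "(flat_exp n has_real_derivative
       (exp (- 1 / x) * (1 / x\<^sup>2) * x ^ n - exp (- 1 / x) * (real n * x ^ (n - 1))) / (x ^ n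
           * x ^ n)) (at x)"
      by (rule has_field_derivative_transform_within_open[of _ _ _ "{0<..}"])
        (use 3 in \<open>auto simp: flat_exp_def\<close>)
    moreover have "(exp (- 1 / x) * (1 / x\<^sup>2) * x ^ n - exp (- 1 / x) * (real n * x ^ (n -
        1))) / (x ^ n * x ^ n)
       = flat_exp (n + 2) x - of_nat n * flat_exp (n + 1) x"
      using 3 by (cases n) (auto simp: flat_exp_def divide_simps power2_eq_square algebra_simps)
    ultimately show ?thesis by simp
  next
    case 2
    \<comment> \<open>To the right of 0 the difference quotient is exp(-1/t) / t^(n+1), whence the
      instance at \<open>Suc n\<close>; to the left it vanishes.\<close>
    have r: "((\<lambda>t. flat_exp n t / t) \<longlongrightarrow> 0) (at_right 0)"
      by (rule Lim_transform_eventually[OF flat_exp_at_right_0[of "Suc n"]])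
        (auto simp: flat_exp_def eventually_at_filter mult.commute)
    have l: "((\<lambda>t. flat_exp n t / t) \<longlongrightarrow> 0) (at_left 0)"
      by (rule Lim_transform_eventually[OF tendsto_const])
        (auto simp: flat_exp_def eventually_at_filter)
    have "((\<lambda>t. flat_exp n t / t) \<longlongrightarrow> 0) (at 0)"
      using l r by (simp add: filterlim_split_at)
    then show ?thesis unfolding 2 has_field_derivative_iff
      by (simp add: flat_exp_def)
  qed
qed

lemma times_cont_diff_flat_exp: "times_cont_diff k (flat_exp n)"
proof (induction k arbitrary: n)
  case 0
  then show ?case using flat_exp_has_derivative
    by (auto intro!: continuous_at_imp_continuous_on DERIV_isCont)
next
  case (Suc k)
  have "times_cont_diff k (\<lambda>x. flat_exp (n + 2) x + (- of_nat n) * flat_exp (n + 1) x)"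
    by (intro times_cont_diff_add times_cont_diff_mult times_cont_diff_const Suc)
  then show ?case using flat_exp_has_derivative[of n]
    by (intro times_cont_diff_SucI[of _ "\<lambda>x. flat_exp (n + 2) x + (- of_nat n) * flat_exp (n + 1) x"])
      (simp_all add: has_real_derivative_iff_has_vector_derivative)
qed

definition smooth_step :: "real \<Rightarrow> real" where
  "smooth_step x = flat_exp 0 x * inverse (flat_exp 0 x + flat_exp 0 (1 - x))"

lemma smooth_step_simps: "x \<le> 0 \<Longrightarrow> smooth_step x = 0" "x \<ge> 1
    \<Longrightarrow> smooth_step x = 1"
  by (auto simp: smooth_step_def flat_exp_def)

lemma smooth_step_bounds: "0 \<le> smooth_step x" "smooth_step x \<le> 1"
  by (auto simp: smooth_step_def flat_exp_def field_simps add_pos_pos)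

lemma times_cont_diff_smooth_step: "times_cont_diff k smooth_step"
proof -
  \<comment> \<open>The summands are nonnegative, and \<open>x\<close> and \<open>1 - x\<close>
    cannot both be nonpositive, so one summand is positive.\<close>
  have nz: "flat_exp 0 x + flat_exp 0 (1 - x) \<noteq> 0" for x
    by (cases "x > 0"; cases "x < 1") (auto simp: flat_exp_def add_pos_pos add_pos_nonneg
        less_imp_neq[symmetric])
  have "times_cont_diff k (\<lambda>x. flat_exp 0 (1 - x))"
    using times_cont_diff_affine[OF times_cont_diff_flat_exp, of k 0 "-1" 1] by (simp add: algebra_simps)
  then have "times_cont_diff k (\<lambda>x. flat_exp 0 x * inverse (flat_exp 0 x + flat_exp 0 (1 - x)))"
    by (intro times_cont_diff_mult times_cont_diff_inverse times_cont_diff_add times_cont_diff_flat_exp nz)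
  then show ?thesis
    by (simp add: smooth_step_def[abs_def])
qed

text \<open>The affine arguments place the two transitions at 1/2 <= |x| <= 3/5. The bound 3/5 is
  small enough for the square of half-side 3/5 to lie in the unit disc, since its half-diagonal is
  below 9/10.\<close>

definition plateau :: "real \<Rightarrow> real" where
  "plateau x = smooth_step (6 - 10 * x) * smooth_step (6 + 10 * x)"

lemma times_cont_diff_plateau: "times_cont_diff k plateau"
  using times_cont_diff_mult[OF times_cont_diff_affine times_cont_diff_affine,
     OF times_cont_diff_smooth_step times_cont_diff_smooth_step, of k "-10" 6 10 6]
  by (simp add: plateau_def[abs_def] algebra_simps)

lemma plateau_eq_1: "\<bar>x\<bar> \<le> 1/2 \<Longrightarrow> plateau x = 1"
  by (auto simp: plateau_def smooth_step_simps)

lemma plateau_eq_0: "\<bar>x\<bar> \<ge> 3/5 \<Longrightarrow> plateau x = 0"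
  by (auto simp: plateau_def smooth_step_simps abs_if split: if_splits)

lemma plateau_bounds: "0 \<le> plateau x" "plateau x \<le> 1"
  by (auto simp: plateau_def smooth_step_bounds intro!: mult_le_one)

text \<open>A finite bound \<open>B\<close> exists because the derivative is continuous and vanishes
  outside the compact interval [-3/5, 3/5]. All constants of the final estimate go back to this
  \<open>B\<close>.\<close>

lemma plateau_derivative:
  obtains p' B where "\<And>x. (plateau has_real_derivative p' x) (at x)" "continuous_on UNIV p'"
    "\<And>x. \<bar>x\<bar> < 1/2 \<Longrightarrow> p' x = 0" "B > 0" "\<And>x. \<bar>p' x\<bar> \<le> B"
proof -
  obtain p' where p': "\<And>x. (plateau has_real_derivative p' x) (at x)" "times_cont_diff 0 p'"
    using times_cont_diff_plateau[of "Suc 0"] by (auto simp: has_real_derivative_iff_has_vector_derivative)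
  then have cont: "continuous_on UNIV p'" by simp
  have inner: "p' x = 0" if "\<bar>x\<bar> < 1/2" for x
  proof -
    have "((\<lambda>_. 1) has_real_derivative 0) (at x)" by simp
    then have "(plateau has_real_derivative 0) (at x)"
      by (rule has_field_derivative_transform_within_open[of _ _ _ "{-1/2<..<1/2}"])
        (use that in \<open>auto simp: plateau_eq_1\<close>)
    then show ?thesis using p' DERIV_unique by blast
  qed
  have outer: "p' x = 0" if "\<bar>x\<bar> > 3/5" for x
  proof -
    have "((\<lambda>_. 0) has_real_derivative 0) (at x)" by simp
    then have "(plateau has_real_derivative 0) (at x)"
      by (rule has_field_derivative_transform_within_open[of _ _ _ "{..<-3/5} \<union> {3/5<..}"])
        (use that in \<open>auto simp: plateau_eq_0\<close>)
    then show ?thesis using p' DERIV_unique by blast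
  qed
  have "compact (p' ` {-3/5..3/5})"
    by (intro compact_continuous_image continuous_on_subset[OF cont]) auto
  then have "bounded (p' ` {-3/5..3/5})" by (rule compact_imp_bounded)
  then obtain B where "B > 0" and "\<forall>y\<in>p' ` {-3/5..3/5}. norm y \<le> B"
    unfolding bounded_pos by blast
  then have B: "B > 0" "\<And>x. x \<in> {-3/5..3/5} \<Longrightarrow> norm (p' x) \<le> B"
    by blast+
  have "\<bar>p' x\<bar> \<le> B" for x
  proof (cases "\<bar>x\<bar> \<le> 3/5")
    case True
    then have "x \<in> {-3/5..3/5}" by auto
    from B(2)[OF this] show ?thesis by simp
  next
    case False
    then show ?thesis using outer[of x] B(1) by simp
  qed
  then show ?thesis using p' cont inner B(1) that by blast
qed

section \<open>Cutoff functions on the disc\<close>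

lemma has_derivative_Re_Im_product:
  fixes F H :: "real \<Rightarrow> complex"
  assumes "(F has_vector_derivative F') (at (Re z))" "(H has_vector_derivative H') (at (Im z))"
  shows "((\<lambda>z. F (Re z) * H (Im z)) has_derivative
    (\<lambda>h. F (Re z) * (Im h *\<^sub>R H') + (Re h *\<^sub>R F') * H (Im z))) (at z)"
proof -
  have "((\<lambda>z. F (Re z)) has_derivative (\<lambda>h. Re h *\<^sub>R F')) (at z)"
    using has_derivative_compose[OF has_derivative_Re[OF has_derivative_ident] assms(1)[unfolded
        has_vector_derivative_def]] .
  moreover have "((\<lambda>z. H (Im z)) has_derivative (\<lambda>h. Im h *\<^sub>R H')) (at z)"
    using has_derivative_compose[OF has_derivative_Im[OF has_derivative_ident] assms(2)[unfolded
        has_vector_derivative_def]] .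
  ultimately show ?thesis by (rule has_derivative_mult)
qed

lemma partials_Re_Im_product:
  fixes F H :: "real \<Rightarrow> complex"
  assumes "(F has_vector_derivative F') (at (Re z))" "(H has_vector_derivative H') (at (Im z))"
  shows "(\<lambda>z. F (Re z) * H (Im z)) differentiable (at z)"
    "partial_x (\<lambda>z. F (Re z) * H (Im z)) z = F' * H (Im z)"
    "partial_y (\<lambda>z. F (Re z) * H (Im z)) z = F (Re z) * H'"
  unfolding partial_x_def partial_y_def
  using has_derivative_Re_Im_product[OF assms] frechet_derivative_at[OF
      has_derivative_Re_Im_product[OF assms], symmetric]
  by (auto simp: differentiable_def)

text \<open>Both partial derivatives of F(x) H(y) again have separated variables, with one factor
  differentiated, so the induction never leaves this class.\<close>

lemma C_k_Re_Im_product: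
  fixes F H :: "real \<Rightarrow> complex"
  shows "times_cont_diff k F \<Longrightarrow> times_cont_diff k H \<Longrightarrow> C_k k
      (\<lambda>z. F (Re z) * H (Im z))"
proof (induction k arbitrary: F H)
  case 0
  then show ?case
    by (auto intro!: continuous_intros continuous_on_compose2[of UNIV F] continuous_on_compose2[of UNIV H])
next
  case (Suc k)
  obtain F' where F': "\<And>x. (F has_vector_derivative F' x) (at x)" "times_cont_diff k F'"
    using Suc.prems by auto
  obtain H' where H': "\<And>x. (H has_vector_derivative H' x) (at x)" "times_cont_diff k H'"
    using Suc.prems by auto
  have "times_cont_diff k F" "times_cont_diff k H"
    using Suc.prems by (blast intro: times_cont_diff_Suc_D)+
  moreover have "partial_x (\<lambda>z. F (Re z) * H (Im z)) = (\<lambda>z. F' (Re z) * H (Im z))"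
    "partial_y (\<lambda>z. F (Re z) * H (Im z)) = (\<lambda>z. F (Re z) * H' (Im z))"
    using partials_Re_Im_product[OF F'(1) H'(1)] by blast+
  ultimately show ?case
    using Suc.IH F'(2) H'(2) partials_Re_Im_product(1)[OF F'(1) H'(1)] by simp
qed

section \<open>The cutoff and plane waves\<close>

definition cutoff :: "complex \<Rightarrow> real \<Rightarrow> complex \<Rightarrow> real" where
  "cutoff z\<^sub>0 r z = plateau ((Re z - Re z\<^sub>0) / r) * plateau ((Im z - Im z\<^sub>0) / r)"

definition wave :: "real \<Rightarrow> real \<Rightarrow> complex \<Rightarrow> complex" where
  "wave a b z = cis (a * Re z) * cis (b * Im z)"

lemma norm_wave [simp]: "cmod (wave a b z) = 1"
  by (simp add: wave_def norm_mult)

lemma continuous_on_wave [continuous_intros]: "continuous_on S (wave a b)"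
  unfolding wave_def[abs_def] by (intro continuous_intros)

lemma continuous_on_cutoff: "continuous_on S (cutoff z\<^sub>0 r)"
proof -
  have cp: "continuous_on UNIV plateau" using times_cont_diff_plateau[of 0] by simp
  have "continuous_on S (\<lambda>z. plateau ((Re z - Re z\<^sub>0) / r))" "continuous_on S
      (\<lambda>z. plateau ((Im z - Im z\<^sub>0) / r))"
    unfolding divide_inverse by (rule continuous_on_compose2[OF cp]; intro continuous_intros subset_UNIV)+
  then show ?thesis unfolding cutoff_def[abs_def] by (rule continuous_on_mult)
qed

lemma cutoff_bounds: "0 \<le> cutoff z\<^sub>0 r z" "cutoff z\<^sub>0 r z \<le> 1"
  by (auto simp: cutoff_def plateau_bounds intro!: mult_le_one)

lemma cutoff_eq_1:
  assumes "z \<in> ball z\<^sub>0 (r / 2)"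
  shows "cutoff z\<^sub>0 r z = 1"
proof -
  have "0 < r / 2" using assms by (metis dist_not_less_zero linorder_not_le mem_ball order.strict_trans2)
  then have r: "r > 0" by simp
  have "\<bar>Re z - Re z\<^sub>0\<bar> < r / 2" "\<bar>Im z - Im z\<^sub>0\<bar> < r / 2"
    using assms abs_Re_le_cmod[of "z - z\<^sub>0"] abs_Im_le_cmod[of "z - z\<^sub>0"] by (auto
        simp: dist_norm norm_minus_commute)
  then have "\<bar>(Re z - Re z\<^sub>0) / r\<bar> \<le> 1/2" "\<bar>(Im z - Im z\<^sub>0) /
      r\<bar> \<le> 1/2"
    using r by (simp_all add: abs_divide pos_divide_le_eq)
  then show ?thesis by (simp add: cutoff_def plateau_eq_1)
qed

text \<open>Serves two purposes: it puts the support of the cutoff inside the disc, and it makes the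
  cutoff vanish on the boundary of the surrounding square.\<close>

lemma cutoff_nonzero:
  assumes "cutoff z\<^sub>0 r z \<noteq> 0" "r > 0"
  shows "\<bar>Re z - Re z\<^sub>0\<bar> < 3/5 * r" "\<bar>Im z - Im z\<^sub>0\<bar> < 3/5 * r"
proof -
  have "\<bar>x / r\<bar> < 3/5 \<Longrightarrow> \<bar>x\<bar> < 3/5 * r" for x
    using assms(2) by (simp add: abs_divide pos_divide_less_eq)
  moreover have "\<bar>(Re z - Re z\<^sub>0) / r\<bar> < 3/5" "\<bar>(Im z - Im z\<^sub>0) / r\<bar> < 3/5"
    using assms(1) plateau_eq_0 unfolding cutoff_def by (metis mult_eq_0_iff not_less)+
  ultimately show "\<bar>Re z - Re z\<^sub>0\<bar> < 3/5 * r" "\<bar>Im z - Im z\<^sub>0\<bar> <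
      3/5 * r" by blast+
qed

text \<open>Separates the variables, which is why the cutoff is a product of one-variable plateaus
  and not a radial function.\<close>

lemma cutoff_wave_product:
  "of_real (cutoff z\<^sub>0 r z) * wave a b z =
    (of_real (plateau (1 / r * Re z + - Re z\<^sub>0 / r)) * cis (a * Re z)) * (of_real (plateau (1
        / r * Im z + - Im z\<^sub>0 / r)) * cis (b * Im z))"
  by (simp add: cutoff_def wave_def diff_divide_distrib)

lemma test_function_cutoff_wave:
  assumes "r > 0"
  shows "test_function (ball z\<^sub>0 r) (\<lambda>z. of_real (cutoff z\<^sub>0 r z) * wave a b
      z)" (is "test_function _ ?\<phi>")
proof -
  have "C_k k ?\<phi>" for k unfolding cutoff_wave_product
    by (intro C_k_Re_Im_product[of k "\<lambda>x. of_real (plateau (1 / r * x + - Re z\<^sub>0 /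
        r)) * cis (a * x)" "\<lambda>x. of_real (plateau (1 / r * x + - Im z\<^sub>0 / r)) * cis (b * x)"] 
      times_cont_diff_mult times_cont_diff_of_real times_cont_diff_cis
      times_cont_diff_affine[OF times_cont_diff_plateau])
  \<comment> \<open>The factor 9/10 lies between the half-diagonal 3/5 * sqrt 2 and 1: the closed
    disc contains the support and is itself contained in the open disc.\<close>
  moreover have *: "closure {z. ?\<phi> z \<noteq> 0} \<subseteq> cball z\<^sub>0 (9/10 * r)"
  proof (rule closure_minimal)
    show "{z. ?\<phi> z \<noteq> 0} \<subseteq> cball z\<^sub>0 (9/10 * r)"
    proof safe
      fix z assume "?\<phi> z \<noteq> 0"
      then have "cutoff z\<^sub>0 r z \<noteq> 0" by auto
      note nz = cutoff_nonzero[OF this assms]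
      have "(Re z - Re z\<^sub>0)\<^sup>2 \<le> (3/5 * r)\<^sup>2" "(Im z - Im z\<^sub>0)\<^sup>2
          \<le> (3/5 * r)\<^sup>2"
        using nz by (simp_all add: abs_le_square_iff[symmetric])
      moreover have "(3/5 * r)\<^sup>2 + (3/5 * r)\<^sup>2 \<le> (9/10 * r)\<^sup>2"
        by (simp add: power_mult_distrib power2_eq_square)
      ultimately have "(dist z\<^sub>0 z)\<^sup>2 \<le> (9/10 * r)\<^sup>2"
        by (simp add: dist_norm cmod_power2 power2_commute[of "Re z\<^sub>0"] power2_commute[of "Im
            z\<^sub>0"])
      then show "z \<in> cball z\<^sub>0 (9/10 * r)"
        using assms power2_le_imp_le[of "dist z\<^sub>0 z" "9/10 * r"] by simp
    qed
  qed simp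
  moreover have "compact (closure {z. ?\<phi> z \<noteq> 0})"
    using * by (meson bounded_cball bounded_subset compact_eq_bounded_closed closed_closure)
  moreover have "cball z\<^sub>0 (9/10 * r) \<subseteq> ball z\<^sub>0 r" using assms by auto
  ultimately show ?thesis unfolding test_function_def by blast
qed

text \<open>\<open>D\<close> is dbar of the cutoff alone and does not depend on the wave; the other
  term comes from differentiating the wave. \<open>B\<close> is chosen before the disc, whose size
  enters only through the factor 1/r; this keeps the final constant absolute.\<close>

lemma dbar_cutoff_wave:
  obtains B :: real where "B > 0"
    "\<And>z\<^sub>0 r. r > 0 \<Longrightarrow> \<exists>D. continuous_on UNIV D \<and>
        (\<forall>z. cmod (D z) \<le> B / r) \<and>
       (\<forall>z\<in>ball z\<^sub>0 (r / 2). D z = 0) \<and>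
       (\<forall>a b z. dbar (\<lambda>z. of_real (cutoff z\<^sub>0 r z) * wave a b z) z =
         (D z + of_real (cutoff z\<^sub>0 r z) * (\<i> * of_real a - of_real b) / 2) * wave a b z)"
proof -
  obtain p' B where p': "\<And>x. (plateau has_real_derivative p' x) (at x)" "continuous_on UNIV p'"
    "\<And>x. \<bar>x\<bar> < 1/2 \<Longrightarrow> p' x = 0" "B > 0" "\<And>x. \<bar>p' x\<bar> \<le> B"
    using plateau_derivative by blast
  have cp: "continuous_on UNIV plateau" using times_cont_diff_plateau[of 0] by simp
  show ?thesis
  proof (rule that[OF p'(4)])
    fix z\<^sub>0 :: complex and r :: real assume r: "r > 0"
    define X where "X z = 1 / r * Re z + - Re z\<^sub>0 / r" for z
    define Y where "Y z = 1 / r * Im z + - Im z\<^sub>0 / r" for z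
    \<comment> \<open>The denominator combines the 1/2 in dbar with the 1/r of the chain
      rule.\<close>
    define D :: "complex \<Rightarrow> complex" where
      "D z = (of_real (p' (X z) * plateau (Y z)) + \<i> * of_real (plateau (X z) * p' (Y z))) /
          of_real (2 * r)" for z
    have XY: "continuous_on UNIV X" "continuous_on UNIV Y"
      unfolding X_def[abs_def] Y_def[abs_def] by (intro continuous_intros)+
    have "continuous_on UNIV (\<lambda>z. p' (X z))" "continuous_on UNIV (\<lambda>z. p' (Y z))"
      "continuous_on UNIV (\<lambda>z. plateau (X z))" "continuous_on UNIV (\<lambda>z. plateau (Y z))"
      using XY by (auto intro: continuous_on_compose2[OF p'(2)] continuous_on_compose2[OF cp])
    then have "continuous_on UNIV D" unfolding D_def[abs_def] divide_inverse
      by (intro continuous_intros)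
    moreover have "cmod (D z) \<le> B / r" for z
    proof -
      have "cmod (of_real (p' (X z) * plateau (Y z)) + \<i> * of_real (plateau (X z) * p' (Y z)))
          \<le> \<bar>p' (X z) * plateau (Y z)\<bar> + \<bar>plateau (X z) * p' (Y z)\<bar>"
        by (rule order_trans[OF norm_triangle_ineq]) (simp add: norm_mult abs_mult)
      also have "\<dots> \<le> B * 1 + 1 * B" unfolding abs_mult
        using p'(4) by (intro add_mono mult_mono p'(5)) (auto simp: plateau_bounds)
      finally show ?thesis using r by (simp add: D_def norm_divide divide_simps)
    qed
    moreover have "D z = 0" if "z \<in> ball z\<^sub>0 (r / 2)" for z
    proof -
      have "\<bar>Re z - Re z\<^sub>0\<bar> < r / 2" "\<bar>Im z - Im z\<^sub>0\<bar> < r / 2"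
        using that abs_Re_le_cmod[of "z - z\<^sub>0"] abs_Im_le_cmod[of "z - z\<^sub>0"] by (auto
            simp: dist_norm norm_minus_commute)
      then have "\<bar>X z\<bar> < 1/2" "\<bar>Y z\<bar> < 1/2" using r
        by (simp_all add: X_def Y_def diff_divide_distrib[symmetric] abs_divide pos_divide_less_eq)
      then show ?thesis by (simp add: D_def p'(3))
    qed
    moreover have "dbar (\<lambda>z. of_real (cutoff z\<^sub>0 r z) * wave a b z) z =
         (D z + of_real (cutoff z\<^sub>0 r z) * (\<i> * of_real a - of_real b) / 2) * wave a b z" for a b z
    proof -
      have der: "((\<lambda>x. of_real (plateau (1 / r * x + - t / r)) * cis (c * x)) has_vector_derivative
         (of_real (p' (1 / r * x + - t / r) / r) + of_real (plateau (1 / r * x + - t / r)) * \<i> *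
             of_real c) * cis (c * x)) (at x)"
         for c t x
      proof -
        have "((\<lambda>x. plateau (1 / r * x + - t / r)) has_real_derivative p' (1 / r * x + - t
            / r) * (1 / r)) (at x)"
          by (rule DERIV_chain2[OF p'(1)]) (use r in \<open>auto intro!: derivative_eq_intros\<close>)
        then have 1: "((\<lambda>x. of_real (plateau (1 / r * x + - t / r)) :: complex) has_vector_derivative
             of_real (p' (1 / r * x + - t / r) / r)) (at x)"
          by (intro has_vector_derivative_of_real) simp
        have 2: "((\<lambda>x. cis (c * x)) has_vector_derivative (\<i> * of_real c) * cis (c * x)) (at x)"
          unfolding cis_conv_exp
          by (rule derivative_eq_intros has_vector_derivative_real_field refl | simp)+
        show ?thesis
          using has_vector_derivative_mult[OF 1 2] by (simp add: algebra_simps)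
      qed
      show ?thesis
        unfolding dbar_def cutoff_wave_product partials_Re_Im_product(2)[OF der der]
            partials_Re_Im_product(3)[OF der der]
        unfolding D_def X_def[symmetric] Y_def[symmetric] wave_def
        using r by (simp add: cutoff_def X_def Y_def diff_divide_distrib) (simp add: field_simps)
    qed
    ultimately show "\<exists>D. continuous_on UNIV D \<and> (\<forall>z. cmod (D z) \<le> B / r) \<and>
       (\<forall>z\<in>ball z\<^sub>0 (r / 2). D z = 0) \<and>
       (\<forall>a b z. dbar (\<lambda>z. of_real (cutoff z\<^sub>0 r z) * wave a b z) z =
         (D z + of_real (cutoff z\<^sub>0 r z) * (\<i> * of_real a - of_real b) / 2) * wave a b z)" by blast
  qed
qed

section \<open>Orthogonality on a square\<close>

text \<open>Gives access to Fubini in the real and imaginary parts: the image of the product measure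
  assigns every box its area, and this characterises Lebesgue measure.\<close>

lemma distr_Complex_lborel:
  "distr (lborel \<Otimes>\<^sub>M lborel) borel (\<lambda>(x, y). Complex x y) = (lborel :: complex measure)"
proof (rule lborel_eqI[symmetric])
  have [measurable]: "(\<lambda>(x, y). Complex x y) \<in> borel_measurable (lborel \<Otimes>\<^sub>M lborel)"
    by (simp add: Complex_eq split_beta')
  fix l u :: complex
  assume lu: "\<And>b. b \<in> Basis \<Longrightarrow> l \<bullet> b \<le> u \<bullet> b"
  have le: "Re l \<le> Re u" "Im l \<le> Im u" using lu[of 1] lu[of \<i>] by (auto simp: Basis_complex_def)
  have vimage: "(\<lambda>(x, y). Complex x y) -` box l u \<inter> space (lborel \<Otimes>\<^sub>M
      lborel) = {Re l<..<Re u} \<times> {Im l<..<Im u}"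
    by (auto simp: in_box_complex_iff space_pair_measure)
  show "emeasure (distr (lborel \<Otimes>\<^sub>M lborel) borel (\<lambda>(x, y). Complex x y))
      (box l u) = ennreal (\<Prod>b\<in>Basis. (u - l) \<bullet> b)"
    using le by (simp add: emeasure_distr vimage lborel.emeasure_pair_measure_Times ennreal_mult
        Basis_complex_def
        inner_diff_left)
qed simp

lemma
  fixes A B :: "real \<Rightarrow> complex"
  assumes A: "integrable lborel A" and B: "integrable lborel B"
  shows integrable_Re_Im_product: "integrable lborel (\<lambda>z. A (Re z) * B (Im z))"
    and integral_Re_Im_product: "(LINT z|lborel. A (Re z) * B (Im z)) = (LINT x|lborel. A x) *
        (LINT y|lborel. B y)"
proof -
  have m: "A \<in> borel_measurable borel" "B \<in> borel_measurable borel"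
    using A B by (auto dest: borel_measurable_integrable)
  have [measurable]: "(\<lambda>(x, y). Complex x y) \<in> borel_measurable (lborel \<Otimes>\<^sub>M lborel)"
    by (simp add: Complex_eq split_beta')
  have [measurable]: "(\<lambda>z. A (Re z) * B (Im z)) \<in> borel_measurable borel"
    using m by measurable
  have ip: "integrable (lborel \<Otimes>\<^sub>M lborel) (\<lambda>(x, y). A x * B y)"
    using m A B by (intro lborel_pair.Fubini_integrable) (auto simp: norm_mult split_beta')
  have eq: "(\<lambda>p. A (Re (case p of (x, y) \<Rightarrow> Complex x y)) * B (Im (case p of (x,
      y) \<Rightarrow> Complex x y))) = (\<lambda>(x, y). A x * B y)"
    by auto
  show "integrable lborel (\<lambda>z. A (Re z) * B (Im z))"
    by (subst distr_Complex_lborel[symmetric], subst integrable_distr_eq) (simp_all add: eq ip)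
  have "(LINT z|lborel. A (Re z) * B (Im z)) = integral\<^sup>L (lborel \<Otimes>\<^sub>M lborel)
      (\<lambda>(x, y). A x * B y)"
    by (subst distr_Complex_lborel[symmetric], subst integral_distr) (simp_all add: eq)
  also have "\<dots> = (LINT x|lborel. LINT y|lborel. A x * B y)"
    using lborel_pair.integral_fst[OF ip] by simp
  finally show "(LINT z|lborel. A (Re z) * B (Im z)) = (LINT x|lborel. A x) * (LINT y|lborel. B y)"
    by simp
qed

text \<open>For nonzero \<open>n\<close>, an interval of length \<open>2 * r\<close> consists of |n|
  full periods, so the antiderivative takes the same value at both ends, wherever the centre
  lies.\<close>

lemma integral_cis_period:
  fixes n :: int
  assumes r: "r > 0"
  shows "(LINT x|lborel. indicator {c - r..c + r} x *\<^sub>R cis (pi / r * of_int n * x)) = (if n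
      = 0 then of_real (2 * r) else 0)"
proof -
  define k where "k = pi / r * of_int n"
  have "(LINT x:{c - r..c + r}|lborel. cis (k * x)) = integral {c - r..c + r} (\<lambda>x. cis (k * x))"
    by (intro set_borel_integral_eq_integral borel_integrable_atLeastAtMost') (intro continuous_intros)
  also have "\<dots> = (if n = 0 then of_real (2 * r) else 0)"
  proof (cases "n = 0")
    case True
    then show ?thesis using r by (simp add: k_def cis_zero scaleR_conv_of_real)
  next
    case False
    then have k: "k \<noteq> 0" using r by (simp add: k_def)
    have "((\<lambda>x. cis (k * x)) has_integral cis (k * (c + r)) / (\<i> * of_real k) - cis (k *
        (c - r)) / (\<i> * of_real k)) {c - r..c + r}"
    proof (rule fundamental_theorem_of_calculus)
      fix x
      have "((\<lambda>x. cis (k * x)) has_vector_derivative (\<i> * of_real k) * cis (k * x)) (at x)"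
        unfolding cis_conv_exp
        by (rule derivative_eq_intros has_vector_derivative_real_field refl | simp)+
      then have "((\<lambda>x. cis (k * x) / (\<i> * of_real k)) has_vector_derivative (\<i> *
          of_real k) * cis (k * x) / (\<i> * of_real k)) (at x)"
        by (rule has_vector_derivative_divide)
      then show "((\<lambda>x. cis (k * x) / (\<i> * of_real k)) has_vector_derivative cis (k * x))
          (at x within {c - r..c + r})"
        using k by (simp add: has_vector_derivative_at_within)
    qed (use r in simp)
    moreover have "cis (k * (c + r)) = cis (k * (c - r))"
    proof -
      have "k * (c + r) = k * (c - r) + 2 * pi * of_int n"
        using r by (simp add: k_def field_simps)
      then show ?thesis by (simp add: cis_mult[symmetric] cis_multiple_2pi)
    qed
    ultimately show ?thesis using False by (simp add: integral_unique)
  qed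
  finally show ?thesis by (simp add: set_lebesgue_integral_def k_def)
qed

section \<open>Plane waves on the square\<close>

definition square :: "complex \<Rightarrow> real \<Rightarrow> complex set" where
  "square z\<^sub>0 r = cbox (z\<^sub>0 - Complex r r) (z\<^sub>0 + Complex r r)"

lemma mem_square: "z \<in> square z\<^sub>0 r \<longleftrightarrow> \<bar>Re z - Re z\<^sub>0\<bar>
    \<le> r \<and> \<bar>Im z - Im z\<^sub>0\<bar> \<le> r"
  by (auto simp: square_def in_cbox_complex_iff)

lemma compact_square: "compact (square z\<^sub>0 r)"
  by (simp add: square_def compact_cbox)

lemma sets_square [measurable]: "square z\<^sub>0 r \<in> sets borel" "square z\<^sub>0 r \<in> sets lebesgue"
  by (simp_all add: square_def)

lemma ball_subset_square: "ball z\<^sub>0 r \<subseteq> square z\<^sub>0 r"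
proof
  fix z assume "z \<in> ball z\<^sub>0 r"
  then show "z \<in> square z\<^sub>0 r"
    using abs_Re_le_cmod[of "z - z\<^sub>0"] abs_Im_le_cmod[of "z - z\<^sub>0"]
    by (auto simp: mem_square dist_norm norm_minus_commute)
qed

lemma integrable_continuous_on_square:
  fixes f :: "complex \<Rightarrow> 'a::euclidean_space"
  assumes "continuous_on (square z\<^sub>0 r) f"
  shows "integrable (lebesgue_on (square z\<^sub>0 r)) f"
  using continuous_imp_integrable[of "z\<^sub>0 - Complex r r" "z\<^sub>0 + Complex r r" f] assms
      by (simp add: square_def)

lemma integral_wave_square:
  fixes m n :: int
  assumes r: "r > 0"
  shows "(LINT z|lebesgue_on (square z\<^sub>0 r). wave (pi / r * of_int m) (pi / r * of_int n) z)
    = (if m = 0 \<and> n = 0 then of_real (4 * r\<^sup>2) else 0)"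
proof -
  let ?I = "\<lambda>c k x. indicator {c - r..c + r} x *\<^sub>R cis (pi / r * of_int k * x)"
  have I: "integrable lborel (?I c k)" for c k
    by (rule borel_integrable_atLeastAtMost'[unfolded set_integrable_def]) (intro continuous_intros)
  have eq: "indicator (square z\<^sub>0 r) z *\<^sub>R wave (pi / r * of_int m) (pi / r * of_int n)
      z = ?I (Re z\<^sub>0) m (Re z) * ?I (Im z\<^sub>0) n (Im z)" for z
    by (auto simp: wave_def indicator_def mem_square abs_le_iff)
  have "(LINT z|lebesgue_on (square z\<^sub>0 r). wave (pi / r * of_int m) (pi / r * of_int n) z)
     = (LINT z|lebesgue. indicator (square z\<^sub>0 r) z *\<^sub>R wave (pi / r * of_int m) (pi /
         r * of_int n) z)"
    by (rule integral_restrict_space) simp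
  also have "\<dots> = (LINT z|lebesgue. ?I (Re z\<^sub>0) m (Re z) * ?I (Im z\<^sub>0) n (Im z))"
    unfolding eq ..
  also have "\<dots> = (LINT z|lborel. ?I (Re z\<^sub>0) m (Re z) * ?I (Im z\<^sub>0) n (Im z))"
    using integrable_Re_Im_product[OF I I] by (intro integral_completion) (auto dest:
        borel_measurable_integrable)
  also have "\<dots> = (if m = 0 then of_real (2 * r) else 0) * (if n = 0 then of_real (2 * r) else 0)"
    unfolding integral_Re_Im_product[OF I I] integral_cis_period[OF r] ..
  finally show ?thesis by (simp add: power2_eq_square)
qed

lemma wave_mult: "wave a b z * wave a' b' z = wave (a + a') (b + b') z"
  by (simp add: wave_def cis_mult[symmetric] ring_distribs)

lemma cnj_wave: "cnj (wave a b z) = wave (- a) (- b) z"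
  by (simp add: wave_def cis_cnj)

text \<open>With the shift, the functions change sign under the translation by \<open>2 * r\<close>
  in the real direction. This is harmless, as they are used to approximate functions vanishing on
  the boundary of the square.\<close>

definition half_wave :: "real \<Rightarrow> int \<times> int \<Rightarrow> complex \<Rightarrow>
    complex" where
  "half_wave r = (\<lambda>(k, l). wave (pi / r * (of_int k + 1 / 2)) (pi / r * of_int l))"

lemma continuous_on_half_wave [continuous_intros]: "continuous_on S (half_wave r i)"
  by (cases i) (simp add: half_wave_def continuous_on_wave)

lemma norm_half_wave [simp]: "cmod (half_wave r i z) = 1"
  by (cases i) (simp add: half_wave_def)

text \<open>The shift cancels in the product of one half wave with the conjugate of another. What
  remains is a wave with integer frequencies, so only the diagonal terms survive, each with the area
  4r^2 of the square.\<close>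

lemma parseval_half_wave:
  assumes r: "r > 0" and S: "finite S"
  shows "(LINT z|lebesgue_on (square z\<^sub>0 r). (cmod (\<Sum>i\<in>S. c i * half_wave r i
      z))\<^sup>2) = 4 * r\<^sup>2 * (\<Sum>i\<in>S. (cmod (c i))\<^sup>2)"
proof -
  let ?M = "lebesgue_on (square z\<^sub>0 r)"
  have prod: "half_wave r i z * cnj (half_wave r j z) = wave (pi / r * of_int (fst i - fst j)) (pi
      / r * of_int (snd i - snd j)) z" for i j z
    by (cases i, cases j) (simp add: half_wave_def cnj_wave wave_mult algebra_simps)
  have int: "integrable ?M (\<lambda>z. c i * cnj (c j) * wave a b z)" for i j a b
    by (intro integrable_continuous_on_square continuous_intros)
  \<comment> \<open>The computation runs in the complex numbers, where the squared modulus is the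
    product with the conjugate and can be expanded.\<close>
  have "complex_of_real (LINT z|?M. (cmod (\<Sum>i\<in>S. c i * half_wave r i z))\<^sup>2) =
    (LINT z|?M. of_real ((cmod (\<Sum>i\<in>S. c i * half_wave r i z))\<^sup>2))"
    by (rule integral_complex_of_real[symmetric])
  also have "\<dots> = (LINT z|?M. (\<Sum>i\<in>S. \<Sum>j\<in>S. c i * cnj (c j) *
      wave (pi / r * of_int (fst i - fst j)) (pi / r * of_int (snd i - snd j)) z))"
    by (intro Bochner_Integration.integral_cong refl)
      (simp only: complex_norm_square cnj_sum sum_product complex_cnj_mult prod[symmetric]
          mult.assoc mult.left_commute)
  also have "\<dots> = (\<Sum>i\<in>S. \<Sum>j\<in>S. c i * cnj (c j) *
      (if fst i - fst j = 0 \<and> snd i - snd j = 0 then of_real (4 * r\<^sup>2) else 0))"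
    by (subst Bochner_Integration.integral_sum, intro Bochner_Integration.integrable_sum int,
       subst Bochner_Integration.integral_sum, intro int) (simp only: integral_mult_right_zero
           integral_wave_square[OF r])
  also have "\<dots> = (\<Sum>i\<in>S. \<Sum>j\<in>S. if i = j then of_real (4 * r\<^sup>2) * (c i
      * cnj (c j)) else 0)"
    by (intro sum.cong refl) (auto simp: prod_eq_iff)
  also have "\<dots> = of_real (4 * r\<^sup>2 * (\<Sum>i\<in>S. (cmod (c i))\<^sup>2))"
    unfolding of_real_mult of_real_sum complex_norm_square sum_distrib_left using S by simp
  finally show ?thesis using of_real_eq_iff by blast
qed

section \<open>Density of trigonometric polynomials\<close>

text \<open>Given by generators so that closure under products is a double induction; the explicit
  coefficients are recovered in \<open>trig_poly_sum_representation\<close>.\<close>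

inductive trig_poly :: "real \<Rightarrow> (complex \<Rightarrow> complex) \<Rightarrow> bool" for r where
  single: "trig_poly r (\<lambda>z. c * wave (pi / r * of_int k) (pi / r * of_int l) z)"
| add: "trig_poly r p \<Longrightarrow> trig_poly r q \<Longrightarrow> trig_poly r (\<lambda>z. p z + q z)"

lemma trig_poly_mult:
  assumes "trig_poly r p" "trig_poly r q"
  shows "trig_poly r (\<lambda>z. p z * q z)"
  using assms
proof (induction p)
  case (single c k l)
  from single show ?case
  proof (induction q)
    case (single d m n)
    have "c * wave (pi / r * of_int k) (pi / r * of_int l) z * (d * wave (pi / r * of_int m) (pi /
        r * of_int n) z)
      = (c * d) * wave (pi / r * of_int (k + m)) (pi / r * of_int (l + n)) z" for z
      using wave_mult[of "pi / r * of_int k" "pi / r * of_int l" z "pi / r * of_int m" "pi / r * of_int n"]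
      by (simp add: ring_distribs mult_ac)
    then show ?case by (simp only: trig_poly.single)
  qed (simp add: ring_distribs trig_poly.add)
qed (simp add: ring_distribs trig_poly.add)

lemma trig_poly_const: "trig_poly r (\<lambda>z. c)"
  using trig_poly.single[of r c 0 0] by (simp add: wave_def)

lemma trig_poly_scale: "trig_poly r p \<Longrightarrow> trig_poly r (\<lambda>z. c * p z)"
  by (rule trig_poly_mult[OF trig_poly_const])

lemma trig_poly_sum_representation:
  assumes "trig_poly r p"
  shows "\<exists>S c. finite S \<and> (\<forall>z. p z = (\<Sum>(k, l)\<in>S. c (k, l) * wave (pi
      / r * of_int k) (pi / r * of_int l) z))"
  using assms
proof induction
  case (single c k l)
  show ?case by (rule exI[of _ "{(k, l)}"], rule exI[of _ "\<lambda>_. c"]) simp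
next
  case (add p q)
  obtain S c where
    S: "finite S" "\<And>z. p z = (\<Sum>(k, l)\<in>S. c (k, l) * wave (pi / r * of_int k) (pi /
        r * of_int l) z)"
    using add.IH(1) by blast
  obtain S' c' where
    S': "finite S'" "\<And>z. q z = (\<Sum>(k, l)\<in>S'. c' (k, l) * wave (pi / r * of_int k)
        (pi / r * of_int l) z)"
    using add.IH(2) by blast
  define d where "d i = (if i \<in> S then c i else 0) + (if i \<in> S' then c' i else 0)" for i
  have "p z + q z = (\<Sum>(k, l)\<in>S \<union> S'. d (k, l) * wave (pi / r * of_int k) (pi / r
      * of_int l) z)" for z
  proof -
    have "p z = (\<Sum>(k, l)\<in>S \<union> S'. (if (k, l) \<in> S then c (k, l) else 0) * wave
        (pi / r * of_int k) (pi / r * of_int l) z)"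
      unfolding S(2) using S(1) S'(1) by (intro sum.mono_neutral_cong_left) auto
    moreover have "q z = (\<Sum>(k, l)\<in>S \<union> S'. (if (k, l) \<in> S' then c' (k, l) else
        0) * wave (pi / r * of_int k) (pi / r * of_int l) z)"
      unfolding S'(2) using S(1) S'(1) by (intro sum.mono_neutral_cong_left) auto
    ultimately show ?thesis
      by (simp only: sum.distrib[symmetric]) (intro sum.cong refl, auto simp: d_def algebra_simps)
  qed
  then show ?case using S(1) S'(1) by (intro exI[of _ "S \<union> S'"] exI[of _ d]) simp
qed

lemma trig_poly_Re_Im_cis:
  "trig_poly r (\<lambda>z. of_real (Re (cis (pi / r * Re z))))" "trig_poly r (\<lambda>z. of_real
      (Im (cis (pi / r * Re z))))"
  "trig_poly r (\<lambda>z. of_real (Re (cis (pi / r * Im z))))" "trig_poly r (\<lambda>z. of_real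
      (Im (cis (pi / r * Im z))))"
proof -
  have e: "of_real (Re (cis t)) = 1/2 * cis t + 1/2 * cis (- t)"
    "of_real (Im (cis t)) = (- \<i>/2) * cis t + (\<i>/2) * cis (- t)" for t
    by (simp_all add: complex_eq_iff)
  have w: "cis (pi / r * Re z) = wave (pi / r * of_int 1) (pi / r * of_int 0) z"
    "cis (- (pi / r * Re z)) = wave (pi / r * of_int (-1)) (pi / r * of_int 0) z"
    "cis (pi / r * Im z) = wave (pi / r * of_int 0) (pi / r * of_int 1) z"
    "cis (- (pi / r * Im z)) = wave (pi / r * of_int 0) (pi / r * of_int (-1)) z" for z
    by (simp_all add: wave_def)
  show "trig_poly r (\<lambda>z. of_real (Re (cis (pi / r * Re z))))" "trig_poly r (\<lambda>z.
      of_real (Im (cis (pi / r * Re z))))"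
    "trig_poly r (\<lambda>z. of_real (Re (cis (pi / r * Im z))))" "trig_poly r (\<lambda>z.
        of_real (Im (cis (pi / r * Im z))))"
    unfolding e unfolding w by (intro trig_poly.intros)+
qed

text \<open>A real linear functional on pairs of complex numbers is a real combination of the real
  and imaginary parts of the two coordinates. On the torus these are trigonometric polynomials by
  Euler's formulas, and sums and products preserve the class.\<close>

lemma trig_poly_real_polynomial:
  assumes "real_polynomial_function p"
  shows "trig_poly r (\<lambda>z. of_real (p (cis (pi / r * Re z), cis (pi / r * Im z))))"
  using assms
proof induction
  case (linear f)
  then interpret bounded_linear f .
  have e: "f (u, v) = Re u * f (1, 0) + Im u * f (\<i>, 0) + Re v * f (0, 1) + Im v * f (0, \<i>)" for u v
  proof -
    have "(u, v) = Re u *\<^sub>R (1, 0) + Im u *\<^sub>R (\<i>, 0) + Re v *\<^sub>R (0, 1) + Im v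
        *\<^sub>R (0, \<i>)"
      by (simp add: complex_eq_iff)
    then have "f (u, v) = f (Re u *\<^sub>R (1, 0) + Im u *\<^sub>R (\<i>, 0) + Re v *\<^sub>R (0,
        1) + Im v *\<^sub>R (0, \<i>))" by (rule arg_cong)
    then show ?thesis by (simp only: add scaleR real_scaleR_def)
  qed
  have "(\<lambda>z. complex_of_real (f (cis (pi / r * Re z), cis (pi / r * Im z)))) = (\<lambda>z.
      of_real (f (1, 0)) * of_real (Re (cis (pi / r * Re z)))
      + of_real (f (\<i>, 0)) * of_real (Im (cis (pi / r * Re z))) + of_real (f (0, 1)) * of_real
          (Re (cis (pi / r * Im z)))
      + of_real (f (0, \<i>)) * of_real (Im (cis (pi / r * Im z))))" (is "?l = ?r")
    by (rule ext, subst e) (simp only: of_real_add of_real_mult mult.commute)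
  moreover have "trig_poly r ?r"
    by (intro trig_poly.add trig_poly_scale trig_poly_Re_Im_cis)
  ultimately show ?case by simp
next
  case (mult f g)
  then show ?case by (simp add: trig_poly_mult)
qed (simp_all add: trig_poly_const trig_poly.add)

lemma trig_poly_polynomial_function:
  fixes g :: "complex \<times> complex \<Rightarrow> complex"
  assumes "polynomial_function g"
  shows "trig_poly r (\<lambda>z. g (cis (pi / r * Re z), cis (pi / r * Im z)))"
proof -
  have "real_polynomial_function (Re \<circ> g)" "real_polynomial_function (Im \<circ> g)"
    using assms bounded_linear_Re bounded_linear_Im by (auto simp: polynomial_function_def)
  from this[THEN trig_poly_real_polynomial, of r]
  have "trig_poly r (\<lambda>z. of_real (Re (g (cis (pi / r * Re z), cis (pi / r * Im z)))) +
    \<i> * of_real (Im (g (cis (pi / r * Re z), cis (pi / r * Im z)))))"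
    unfolding o_def by (intro trig_poly.add trig_poly_scale)
  then show ?thesis by (simp only: complex_eq[symmetric])
qed

text \<open>Equal values force \<open>x\<close> and \<open>y\<close> to differ by a multiple of
  \<open>2 * r\<close>. In a closed interval of that length, two distinct points with this property
  are its end points.\<close>

lemma cis_eq_on_period:
  assumes r: "r > 0" and eq: "cis (pi / r * x) = cis (pi / r * y)"
    and xy: "\<bar>x - c\<bar> \<le> r" "\<bar>y - c\<bar> \<le> r" and ne: "x \<noteq> y"
  shows "\<bar>x - c\<bar> = r" "\<bar>y - c\<bar> = r"
proof -
  have "exp (\<i> * of_real (pi / r * x)) = exp (\<i> * of_real (pi / r * y))"
    using eq by (simp add: cis_conv_exp)
  then obtain n :: int where "\<i> * of_real (pi / r * x) = \<i> * of_real (pi / r * y) + (of_int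
      (2 * n) * pi) * \<i>"
    by (auto simp: exp_eq)
  then have "Im (\<i> * of_real (pi / r * x)) = Im (\<i> * of_real (pi / r * y) + (of_int (2 * n) *
      pi) * \<i>)" by (rule arg_cong)
  then have "pi / r * x = pi / r * y + 2 * of_int n * pi" by simp
  then have "pi * x = pi * (y + 2 * of_int n * r)" using r by (simp add: field_simps)
  then have n: "x = y + 2 * of_int n * r" by simp
  then have n0: "n \<noteq> 0" using ne by auto
  have "\<bar>2 * of_int n * r\<bar> \<le> 2 * r" using n xy by linarith
  then have "\<bar>of_int n :: real\<bar> \<le> 1" using r by (simp add: abs_mult)
  then have "n = 1 \<or> n = -1" using n0 by (simp add: abs_le_iff) linarith
  then have "x = y + 2 * r \<or> x = y - 2 * r" using n by auto
  then show "\<bar>x - c\<bar> = r" "\<bar>y - c\<bar> = r" using xy by linarith+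
qed

text \<open>Vanishing on the boundary makes \<open>\<Psi>\<close> a function on the torus, embedded
    in \<open>\<complex>\<^sup>2\<close>.\<close>

lemma trig_poly_dense:
  assumes r: "r > 0" and cont: "continuous_on (square z\<^sub>0 r) \<Psi>"
    and zero: "\<And>z. z \<in> square z\<^sub>0 r \<Longrightarrow> \<bar>Re z - Re
        z\<^sub>0\<bar> = r \<or> \<bar>Im z - Im z\<^sub>0\<bar> = r \<Longrightarrow> \<Psi> z = 0"
    and e: "e > 0"
  shows "\<exists>p. trig_poly r p \<and> (\<forall>z\<in>square z\<^sub>0 r. cmod (\<Psi> z - p z) < e)"
proof -
  define T where "T z = (cis (pi / r * Re z), cis (pi / r * Im z))" for z
  let ?Q = "square z\<^sub>0 r"
  \<comment> \<open>This is the function induced on the image of \<open>T\<close>. The preimage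
    chosen by \<open>inv_into\<close> is arbitrary; \<open>FT\<close> shows that the choice does not
    affect the value.\<close>
  define F where "F y = \<Psi> (inv_into ?Q T y)" for y
  have cT: "continuous_on ?Q T" unfolding T_def[abs_def] by (intro continuous_intros)
  have FT: "F (T z) = \<Psi> z" if z: "z \<in> ?Q" for z
  proof -
    define w where "w = inv_into ?Q T (T z)"
    have w: "w \<in> ?Q" "T w = T z"
      using z unfolding w_def by (auto intro: inv_into_into f_inv_into_f)
    have "\<Psi> w = \<Psi> z"
    proof (cases "w = z")
      case False
      have t: "cis (pi / r * Re w) = cis (pi / r * Re z)" "cis (pi / r * Im w) = cis (pi / r * Im z)"
        using w(2) by (auto simp: T_def)
      from False have "Re w \<noteq> Re z \<or> Im w \<noteq> Im z" by (auto simp: complex_eq_iff)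
      then have "(\<bar>Re w - Re z\<^sub>0\<bar> = r \<and> \<bar>Re z - Re z\<^sub>0\<bar> = r)
          \<or> (\<bar>Im w - Im z\<^sub>0\<bar> = r \<and> \<bar>Im z - Im z\<^sub>0\<bar> = r)"
      proof
        assume "Re w \<noteq> Re z"
        then show ?thesis using cis_eq_on_period[OF r t(1), of "Re z\<^sub>0"] z w(1) by (simp add:
            mem_square)
      next
        assume "Im w \<noteq> Im z"
        then show ?thesis using cis_eq_on_period[OF r t(2), of "Im z\<^sub>0"] z w(1) by (simp add:
            mem_square)
      qed
      then show ?thesis using zero[OF w(1)] zero[OF z] by auto
    qed simp
    then show ?thesis by (simp add: F_def w_def)
  qed
  have comp: "compact (T ` ?Q)" by (rule compact_continuous_image[OF cT compact_square])
  \<comment> \<open>\<open>T\<close> acts as a quotient map: by compactness of the square it sends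
    closed subsets to compact ones, so closed preimages under \<open>F\<close> are obtained as
    images of closed preimages under the given function.\<close>
  have "continuous_on (T ` ?Q) F"
    unfolding continuous_on_closed_invariant
  proof safe
    fix C :: "complex set" assume C: "closed C"
    have "closed (?Q \<inter> \<Psi> -` C)"
      by (rule continuous_closed_preimage[OF cont compact_imp_closed[OF compact_square] C])
    moreover have "square z\<^sub>0 r \<inter> (square z\<^sub>0 r \<inter> \<Psi> -` C) = \<Psi> -` C \<inter> square z\<^sub>0 r"
      by blast
    ultimately have "compact (\<Psi> -` C \<inter> square z\<^sub>0 r)"
      using compact_Int_closed[OF compact_square[of z\<^sub>0 r]] by metis
    then have "compact (T ` (\<Psi> -` C \<inter> ?Q))"
      by (intro compact_continuous_image continuous_on_subset[OF cT]) auto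
    moreover have "T ` (\<Psi> -` C \<inter> ?Q) \<inter> T ` ?Q = F -` C \<inter> T ` ?Q"
      using FT by auto
    ultimately show "\<exists>A. closed A \<and> A \<inter> T ` ?Q = F -` C \<inter> T ` ?Q"
      using compact_imp_closed by blast
  qed
  from Stone_Weierstrass_polynomial_function[OF comp this e]
  obtain g where g: "polynomial_function g" "\<And>y. y \<in> T ` ?Q \<Longrightarrow> cmod (F y -
      g y) < e" by blast
  show ?thesis
  proof (intro exI conjI ballI)
    show "trig_poly r (\<lambda>z. g (T z))"
      unfolding T_def by (rule trig_poly_polynomial_function[OF g(1)])
    show "cmod (\<Psi> z - g (T z)) < e" if "z \<in> ?Q" for z
      using g(2)[of "T z"] FT that by auto
  qed
qed

text \<open>Multiplication by a unimodular wave of frequency -1/2 turns half waves into waves with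
  integer frequencies. It preserves continuity, zeros on the boundary and the size of errors, so
  \<open>trig_poly_dense\<close> applies to the twisted function.\<close>

lemma half_wave_dense:
  assumes r: "r > 0" and cont: "continuous_on (square z\<^sub>0 r) \<Psi>"
    and zero: "\<And>z. z \<in> square z\<^sub>0 r \<Longrightarrow> \<bar>Re z - Re
        z\<^sub>0\<bar> = r \<or> \<bar>Im z - Im z\<^sub>0\<bar> = r \<Longrightarrow> \<Psi> z = 0"
    and e: "e > 0"
  shows "\<exists>S c. finite S \<and> (\<forall>z\<in>square z\<^sub>0 r. cmod (\<Psi> z -
      (\<Sum>i\<in>S. c i * half_wave r i z)) < e)"
proof -
  let ?u = "\<lambda>s. wave (s * (pi / r / 2)) 0"
  have uu: "?u 1 z * ?u (- 1) z = 1" for z by (simp add: wave_mult) (simp add: wave_def)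
  have c1: "continuous_on (square z\<^sub>0 r) (\<lambda>z. ?u (- 1) z * \<Psi> z)"
    by (intro continuous_intros cont)
  have c2: "?u (- 1) z * \<Psi> z = 0"
    if "z \<in> square z\<^sub>0 r" "\<bar>Re z - Re z\<^sub>0\<bar> = r \<or> \<bar>Im z - Im
        z\<^sub>0\<bar> = r" for z
    using zero[OF that] by simp
  obtain p where p: "trig_poly r p" "\<And>z. z \<in> square z\<^sub>0 r \<Longrightarrow> cmod (?u
      (- 1) z * \<Psi> z - p z) < e"
    using trig_poly_dense[OF r c1 c2 e] by blast
  obtain S c where S: "finite S" "\<And>z. p z = (\<Sum>(k, l)\<in>S. c (k, l) * wave (pi / r *
      of_int k) (pi / r * of_int l) z)"
    using trig_poly_sum_representation[OF p(1)] by blast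
  have "cmod (\<Psi> z - (\<Sum>i\<in>S. c i * half_wave r i z)) < e" if z: "z \<in> square z\<^sub>0 r" for z
  proof -
    have "?u 1 z * wave (pi / r * of_int k) (pi / r * of_int l) z = half_wave r (k, l) z" for k l
      unfolding wave_mult half_wave_def by (simp add: algebra_simps)
    then have "?u 1 z * p z = (\<Sum>i\<in>S. c i * half_wave r i z)"
      unfolding S(2) sum_distrib_left by (intro sum.cong refl) (auto simp: mult.left_commute)
    moreover have "?u 1 z * (?u (- 1) z * \<Psi> z) = \<Psi> z" using uu[of z] by (simp add:
        mult.assoc[symmetric])
    ultimately have "\<Psi> z - (\<Sum>i\<in>S. c i * half_wave r i z) = ?u 1 z * (?u (- 1) z *
        \<Psi> z - p z)"
      by (simp add: right_diff_distrib)
    then have "cmod (\<Psi> z - (\<Sum>i\<in>S. c i * half_wave r i z)) = cmod (?u (- 1) z * \<Psi> z - p z)"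
      by (simp add: norm_mult)
    with p(2)[OF z] show ?thesis by simp
  qed
  with S(1) show ?thesis by (intro exI[of _ S] exI[of _ c]) simp
qed

section \<open>The estimate for the cut-off function\<close>

text \<open>The factor by which \<open>dbar\<close> multiplies \<open>half_wave r (k, l)\<close>.\<close>

definition half_wave_symbol :: "real \<Rightarrow> int \<times> int \<Rightarrow> complex" where
  "half_wave_symbol r = (\<lambda>(k, l). (\<i> * of_real (pi / r * (of_int k + 1 / 2)) - of_real
      (pi / r * of_int l)) / 2)"

text \<open>The imaginary part alone suffices: it is pi/(4r) times the odd integer 2k + 1, which has
  absolute value at least 1.\<close>

lemma norm_half_wave_symbol:
  assumes r: "r > 0"
  shows "cmod (half_wave_symbol r i) \<ge> pi / (4 * r)"
proof -
  obtain k l where i: "i = (k, l)" by (cases i)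
  have "(1 :: real) \<le> \<bar>2 * of_int k + 1\<bar>"
  proof -
    have "1 \<le> \<bar>2 * k + 1\<bar>" by presburger
    then have "real_of_int 1 \<le> real_of_int \<bar>2 * k + 1\<bar>" by (simp only: of_int_le_iff)
    then show ?thesis by simp
  qed
  then have "pi / (4 * r) * 1 \<le> pi / (4 * r) * \<bar>2 * of_int k + 1\<bar>"
    using r by (intro mult_left_mono) auto
  also have "\<dots> = \<bar>Im (half_wave_symbol r i)\<bar>"
  proof -
    have "Im (half_wave_symbol r i) = pi / (4 * r) * (2 * of_int k + 1)"
      using r by (simp add: i half_wave_symbol_def field_simps)
    then show ?thesis using r by (simp only: abs_mult) simp
  qed
  finally show ?thesis using abs_Im_le_cmod[of "half_wave_symbol r i"] by simp
qed

section \<open>Integrability and measurability on the disc and the square\<close>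

lemma finite_measure_lebesgue_on_ball: "finite_measure (lebesgue_on (ball (z\<^sub>0 :: complex) r))"
  by (simp add: finite_measure_lebesgue_on)

lemma integrable_mult_bounded:
  fixes f g :: "complex \<Rightarrow> complex"
  assumes "integrable M f" "g \<in> borel_measurable M" "\<And>x. x \<in> space M \<Longrightarrow>
      cmod (g x) \<le> B"
  shows "integrable M (\<lambda>x. f x * g x)"
proof (rule Bochner_Integration.integrable_bound)
  show "integrable M (\<lambda>x. B * cmod (f x))" using assms(1) by simp
  show "AE x in M. norm (f x * g x) \<le> norm (B * cmod (f x))"
  proof (rule AE_I2)
    fix x assume "x \<in> space M"
    from assms(3)[OF this] have "cmod (g x) \<le> \<bar>B\<bar>" by simp
    then show "norm (f x * g x) \<le> norm (B * cmod (f x))"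
      by (simp add: norm_mult abs_mult mult.commute[of "cmod (f x)"] mult_right_mono)
  qed
qed (use assms in measurable)

text \<open>The disc has finite measure, so 1 + |f|^2 is an integrable majorant of |f|.\<close>

lemma L2_on_integrable:
  assumes "L2_on (ball z\<^sub>0 r) f"
  shows "integrable (lebesgue_on (ball z\<^sub>0 r)) f"
proof (rule Bochner_Integration.integrable_bound)
  interpret finite_measure "lebesgue_on (ball z\<^sub>0 r)" by (rule finite_measure_lebesgue_on_ball)
  show "integrable (lebesgue_on (ball z\<^sub>0 r)) (\<lambda>z. 1 + (cmod (f z))\<^sup>2)"
    using assms by (auto simp: L2_on_def)
  have "x \<le> 1 + x\<^sup>2" for x :: real
    using sum_squares_bound[of 1 x] zero_le_power2[of x] by (simp; linarith)
  then show "AE z in lebesgue_on (ball z\<^sub>0 r). norm (f z) \<le> norm (1 + (cmod (f z))\<^sup>2)"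
    by (auto intro!: AE_I2)
qed (use assms in \<open>simp add: L2_on_def\<close>)

lemma L2_on_integrable_indicator:
  assumes "L2_on S f" "A \<in> sets lebesgue"
  shows "integrable (lebesgue_on S) (\<lambda>z. indicator A z * (cmod (f z))\<^sup>2)"
proof (rule Bochner_Integration.integrable_bound)
  have [measurable]: "f \<in> borel_measurable (lebesgue_on S)" using assms by (simp add: L2_on_def)
  have [measurable]: "(indicator A :: complex \<Rightarrow> real) \<in> borel_measurable (lebesgue_on S)"
    by (intro measurable_restrict_space1 borel_measurable_indicator assms)
  show "(\<lambda>z. indicator A z * (cmod (f z))\<^sup>2) \<in> borel_measurable (lebesgue_on S)"
      by measurable
  show "integrable (lebesgue_on S) (\<lambda>z. (cmod (f z))\<^sup>2)" using assms by (simp add: L2_on_def)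
qed (auto intro!: AE_I2 simp: indicator_def)

lemma continuous_measurable_ball:
  fixes p :: "complex \<Rightarrow> 'a::euclidean_space"
  shows "continuous_on UNIV p \<Longrightarrow> p \<in> borel_measurable (lebesgue_on (ball z\<^sub>0 r))"
  by (rule continuous_imp_measurable_on_sets_lebesgue) (auto intro: continuous_on_subset)

lemma continuous_measurable_square:
  fixes p :: "complex \<Rightarrow> 'a::euclidean_space"
  shows "continuous_on UNIV p \<Longrightarrow> p \<in> borel_measurable (lebesgue_on (square z\<^sub>0 r))"
  by (rule continuous_imp_measurable_on_sets_lebesgue) (auto intro: continuous_on_subset)

text \<open>Stated with squares on the right, so that for a sum approximating the conjugate of \<open>h\<close> the last
  integral is absorbed by the left-hand side.\<close>

lemma half_wave_sum_pairing:
  assumes r: "r > 0"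
    and h: "integrable (lebesgue_on (ball z\<^sub>0 r)) h" and G: "L2_on (ball z\<^sub>0 r) G"
    and rel: "\<And>i. half_wave_symbol r i * (LINT z|lebesgue_on (ball z\<^sub>0 r). h z * half_wave r i z)
      = (LINT z|lebesgue_on (ball z\<^sub>0 r). G z * half_wave r i z)"
    and S: "finite S"
  shows "2 * cmod (LINT z|lebesgue_on (ball z\<^sub>0 r). h z * (\<Sum>i\<in>S. c i * half_wave r i z))
    \<le> (4 * r / pi)\<^sup>2 * (LINT z|lebesgue_on (ball z\<^sub>0 r). (cmod (G z))\<^sup>2)
      + (LINT z|lebesgue_on (square z\<^sub>0 r). (cmod (\<Sum>i\<in>S. c i * half_wave r i z))\<^sup>2)"
proof -
  let ?U = "lebesgue_on (ball z\<^sub>0 r)" and ?Q = "lebesgue_on (square z\<^sub>0 r)"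
  define s where "s = 4 * r / pi"
  have s: "s > 0" using r by (simp add: s_def)
  \<comment> \<open>Dividing each coefficient by its symbol moves the pairing from \<open>h\<close>
    to \<open>G\<close> through \<open>rel\<close>, with \<open>q\<close> in place of the original
    sum.\<close>
  define d where "d i = c i / half_wave_symbol r i" for i
  define q where "q z = (\<Sum>i\<in>S. d i * half_wave r i z)" for z
  have ms: "cmod (half_wave_symbol r i) \<ge> 1 / s" for i
    using norm_half_wave_symbol[OF r, of i] by (simp add: s_def)
  have nz: "half_wave_symbol r i \<noteq> 0" for i
    using ms[of i] s by auto
  have iG: "integrable ?U G" by (rule L2_on_integrable[OF G])
  have iw: "integrable ?U (\<lambda>z. f z * half_wave r i z)" if "integrable ?U f" for f i
    by (rule integrable_mult_bounded[OF that, of _ 1])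
      (auto intro!: continuous_measurable_ball continuous_intros)
  have cont_q: "continuous_on UNIV q" unfolding q_def[abs_def] by (intro continuous_intros)
  have "(LINT z|?U. h z * (\<Sum>i\<in>S. c i * half_wave r i z)) = (LINT z|?U. (\<Sum>i\<in>S. c i
      * (h z * half_wave r i z)))"
    by (intro Bochner_Integration.integral_cong refl) (simp add: sum_distrib_left mult.left_commute)
  also have "\<dots> = (\<Sum>i\<in>S. c i * (LINT z|?U. h z * half_wave r i z))"
    using iw[OF h] by (subst Bochner_Integration.integral_sum) auto
  also have "\<dots> = (\<Sum>i\<in>S. d i * (LINT z|?U. G z * half_wave r i z))"
    using nz by (simp add: d_def rel[symmetric])
  also have "\<dots> = (LINT z|?U. (\<Sum>i\<in>S. d i * (G z * half_wave r i z)))"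
    using iw[OF iG] by (subst Bochner_Integration.integral_sum) auto
  also have "\<dots> = (LINT z|?U. G z * q z)"
    by (intro Bochner_Integration.integral_cong refl) (simp add: q_def sum_distrib_left mult.left_commute)
  finally have eq: "(LINT z|?U. h z * (\<Sum>i\<in>S. c i * half_wave r i z)) = (LINT z|?U. G z * q z)" .
  have iq: "integrable ?Q (\<lambda>z. (cmod (q z))\<^sup>2)"
    by (intro integrable_continuous_on_square continuous_intros continuous_on_subset[OF cont_q]) simp
  have iqU: "integrable ?U (\<lambda>z. (cmod (q z))\<^sup>2)"
  proof (rule finite_measure.integrable_const_bound[OF finite_measure_lebesgue_on_ball, of _
      "(\<Sum>i\<in>S. cmod (d i))\<^sup>2"])
    have "cmod (q z) \<le> (\<Sum>i\<in>S. cmod (d i))" for z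
      unfolding q_def by (rule order_trans[OF norm_sum]) (simp add: norm_mult)
    then show "AE z in ?U. norm ((cmod (q z))\<^sup>2) \<le> (\<Sum>i\<in>S. cmod (d i))\<^sup>2"
      by (intro AE_I2) (simp add: power_mono)
  qed (intro continuous_measurable_ball continuous_intros cont_q)
  \<comment> \<open>Orthogonality holds on the square and not on the disc, so the domain is enlarged
    first. The lower bound \<open>1 / s\<close> on the symbols then compares the norm of
    \<open>q\<close> with that of the original sum.\<close>
  have "(LINT z|?U. (cmod (q z))\<^sup>2) \<le> (LINT z|?Q. (cmod (q z))\<^sup>2)"
    by (rule integral_mono_lebesgue_on_AE[OF iq]) (use ball_subset_square in auto)
  also have "\<dots> = 4 * r\<^sup>2 * (\<Sum>i\<in>S. (cmod (d i))\<^sup>2)"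
    unfolding q_def by (rule parseval_half_wave[OF r S])
  also have "\<dots> \<le> 4 * r\<^sup>2 * (\<Sum>i\<in>S. s\<^sup>2 * (cmod (c i))\<^sup>2)"
  proof (intro mult_left_mono sum_mono)
    fix i
    have "cmod (d i) \<le> s * cmod (c i)"
    proof -
      have "cmod (c i) * (1 / s) \<le> cmod (c i) * cmod (half_wave_symbol r i)"
        using ms by (rule mult_left_mono) simp
      then show ?thesis using s nz[of i] by (simp add: d_def norm_divide field_simps)
    qed
    then have "(cmod (d i))\<^sup>2 \<le> (s * cmod (c i))\<^sup>2" by (rule power_mono) simp
    then show "(cmod (d i))\<^sup>2 \<le> s\<^sup>2 * (cmod (c i))\<^sup>2" by (simp add: power_mult_distrib)
  qed simp
  also have "\<dots> = s\<^sup>2 * (LINT z|?Q. (cmod (\<Sum>i\<in>S. c i * half_wave r i z))\<^sup>2)"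
    unfolding parseval_half_wave[OF r S] by (simp add: sum_distrib_left mult_ac)
  finally have q_le: "(LINT z|?U. (cmod (q z))\<^sup>2) / s\<^sup>2 \<le> (LINT z|?Q. (cmod
      (\<Sum>i\<in>S. c i * half_wave r i z))\<^sup>2)"
    using s by (simp add: field_simps)
  \<comment> \<open>The weight \<open>s\<close> in this arithmetic-geometric inequality is the one
    for which \<open>q_le\<close> leaves the original sum with coefficient exactly 1.\<close>
  have am: "2 * cmod (G z * q z) \<le> s\<^sup>2 * (cmod (G z))\<^sup>2 + (cmod (q z))\<^sup>2 /
      s\<^sup>2" for z
    using sum_squares_bound[of "s * cmod (G z)" "cmod (q z) / s"] s
    by (simp add: norm_mult power_mult_distrib power_divide)
  have iG2: "integrable ?U (\<lambda>z. (cmod (G z))\<^sup>2)" using G by (simp add: L2_on_def)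
  have "2 * cmod (LINT z|?U. G z * q z) \<le> 2 * (LINT z|?U. cmod (G z * q z))"
    by (intro mult_left_mono integral_norm_bound) simp
  also have "\<dots> = (LINT z|?U. 2 * cmod (G z * q z))" by simp
  also have "\<dots> \<le> (LINT z|?U. s\<^sup>2 * (cmod (G z))\<^sup>2 + (cmod (q z))\<^sup>2 / s\<^sup>2)"
    using iG2 iqU am by (intro integral_mono_AE' AE_I2) (auto intro!: add_nonneg_nonneg)
  also have "\<dots> = s\<^sup>2 * (LINT z|?U. (cmod (G z))\<^sup>2) + (LINT z|?U. (cmod (q
      z))\<^sup>2) / s\<^sup>2"
    using iG2 iqU by simp
  finally show ?thesis using q_le unfolding eq s_def[symmetric] by linarith
qed

text \<open>Passes from half wave sums to \<open>w\<close> times the cutoff, for bounded measurable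
  \<open>w\<close>. The sums approximate this product almost everywhere with a uniform bound, so
  dominated convergence applies to both sides, first with majorant
  \<open>cmod (h z) * (m + 1)\<close>, then with the constant
  \<open>(m + 1)\<^sup>2\<close>.\<close>

lemma cutoff_pairing:
  assumes r: "r > 0"
    and h: "integrable (lebesgue_on (ball z\<^sub>0 r)) h" and G: "L2_on (ball z\<^sub>0 r) G"
    and rel: "\<And>i. half_wave_symbol r i * (LINT z|lebesgue_on (ball z\<^sub>0 r). h z * half_wave r i z)
      = (LINT z|lebesgue_on (ball z\<^sub>0 r). G z * half_wave r i z)"
    and w: "w \<in> borel_measurable lebesgue" "\<And>z. cmod (w z) \<le> m" "\<And>z. z \<notin>
        ball z\<^sub>0 r \<Longrightarrow> w z = 0" and m: "m > 0"
  shows "2 * cmod (LINT z|lebesgue_on (ball z\<^sub>0 r). h z * (of_real (cutoff z\<^sub>0 r z) * w z))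
    \<le> (4 * r / pi)\<^sup>2 * (LINT z|lebesgue_on (ball z\<^sub>0 r). (cmod (G z))\<^sup>2)
      + (LINT z|lebesgue_on (ball z\<^sub>0 r). (cmod (of_real (cutoff z\<^sub>0 r z) * w z))\<^sup>2)"
proof -
  let ?U = "lebesgue_on (ball z\<^sub>0 r)" and ?Q = "lebesgue_on (square z\<^sub>0 r)"
  define k where "k z = of_real (cutoff z\<^sub>0 r z) * w z" for z
  \<comment> \<open>This notion of measurability provides continuous functions converging to
    \<open>w\<close> outside a negligible set.\<close>
  have "w measurable_on UNIV"
    using w(1) by (simp add: measurable_on_iff_borel_measurable lebesgue_on_UNIV_eq)
  then obtain N g where N: "negligible N" and g: "\<And>n. continuous_on UNIV (g n)"
    "\<And>x. x \<notin> N \<Longrightarrow> (\<lambda>n. g n x) \<longlonglongrightarrow> w x"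
    unfolding measurable_on_def by auto
  have AE_N: "AE z in ?U. z \<notin> N" "AE z in ?Q. z \<notin> N"
    using AE_not_in[of N lebesgue] N by (auto simp: AE_restrict_space_iff negligible_iff_null_sets)
  \<comment> \<open>Radial truncation to modulus at most \<open>m\<close>. It is continuous, and it
    does not disturb the limit because \<open>w\<close> itself is bounded by
    \<open>m\<close>.\<close>
  define q where "q n z = of_real (m / max m (cmod (g n z))) * g n z" for n z
  have q_cont: "continuous_on UNIV (q n)" for n
    unfolding q_def[abs_def] using m by (intro continuous_intros g) auto
  have q_bound: "cmod (q n z) \<le> m" for n z
  proof -
    have "m * cmod (g n z) \<le> m * max m (cmod (g n z))" using m by (intro mult_left_mono) auto
    then show ?thesis using m by (simp add: q_def norm_mult norm_divide pos_divide_le_eq)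
  qed
  have q_lim: "(\<lambda>n. q n z) \<longlonglongrightarrow> w z" if "z \<notin> N" for z
  proof -
    have "(\<lambda>n. q n z) \<longlonglongrightarrow> of_real (m / max m (cmod (w z))) * w z"
      unfolding q_def using m by (intro tendsto_intros g(2)[OF that]) auto
    moreover have "max m (cmod (w z)) = m" using w(2) by (simp add: max_absorb1)
    ultimately show ?thesis using m by simp
  qed
  \<comment> \<open>The cutoff factor produces the zeros on the boundary of the square that
    \<open>half_wave_dense\<close> requires.\<close>
  define \<Psi> where "\<Psi> n z = of_real (cutoff z\<^sub>0 r z) * q n z" for n z
  have "\<exists>S c. finite S \<and> (\<forall>z\<in>square z\<^sub>0 r. cmod (\<Psi> n z -
      (\<Sum>i\<in>S. c i * half_wave r i z)) < inverse (Suc n))" for n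
  proof (rule half_wave_dense[OF r])
    show "continuous_on (square z\<^sub>0 r) (\<Psi> n)"
      unfolding \<Psi>_def[abs_def] by (intro continuous_intros continuous_on_cutoff
          continuous_on_subset[OF q_cont]) auto
    show "\<Psi> n z = 0" if "\<bar>Re z - Re z\<^sub>0\<bar> = r \<or> \<bar>Im z - Im
        z\<^sub>0\<bar> = r" for z
      using cutoff_nonzero[OF _ r, of z\<^sub>0 z] that r by (fastforce simp: \<Psi>_def)
  qed simp
  then obtain S c where S: "\<And>n. finite (S n)"
    and S': "\<And>n z. z \<in> square z\<^sub>0 r \<Longrightarrow> cmod (\<Psi> n z -
        (\<Sum>i\<in>S n. c n i * half_wave r i z)) < inverse (Suc n)"
    by metis
  define p where "p n z = (\<Sum>i\<in>S n. c n i * half_wave r i z)" for n z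
  have p_cont: "continuous_on UNIV (p n)" for n
    unfolding p_def[abs_def] by (intro continuous_intros)
  have p: "cmod (\<Psi> n z - p n z) < inverse (Suc n)" if "z \<in> square z\<^sub>0 r" for n z
    using S'[OF that] by (simp add: p_def)
  \<comment> \<open>The approximation error is below 1 for every \<open>n\<close>, whence a bound
    independent of \<open>n\<close>.\<close>
  have p_bound: "cmod (p n z) \<le> m + 1" if "z \<in> square z\<^sub>0 r" for n z
  proof -
    have "cmod (\<Psi> n z) \<le> 1 * m" unfolding \<Psi>_def norm_mult
      using q_bound[of n z] by (intro mult_mono) (auto simp: cutoff_bounds)
    moreover have "inverse (real (Suc n)) \<le> 1" by (simp add: field_simps)
    ultimately show ?thesis
      using p[OF that, of n] norm_triangle_ineq2[of "p n z" "\<Psi> n z"] by (simp add: norm_minus_commute)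
  qed
  have p_lim: "(\<lambda>n. p n z) \<longlonglongrightarrow> k z" if "z \<in> square z\<^sub>0 r"
      "z \<notin> N" for z
  proof -
    have "(\<lambda>n. p n z - \<Psi> n z) \<longlonglongrightarrow> 0"
      using p[OF that(1)] by (intro Lim_null_comparison[OF _ LIMSEQ_inverse_real_of_nat])
        (auto simp: norm_minus_commute intro!: always_eventually less_imp_le)
    moreover have "(\<lambda>n. \<Psi> n z) \<longlonglongrightarrow> k z"
      unfolding \<Psi>_def k_def by (intro tendsto_intros q_lim that)
    ultimately show ?thesis using tendsto_add[of "\<lambda>n. p n z - \<Psi> n z" 0 sequentially
        "\<lambda>n. \<Psi> n z"] by simp
  qed
  have k_meas: "k \<in> borel_measurable lebesgue"
  proof -
    have "cutoff z\<^sub>0 r \<in> borel_measurable lebesgue"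
      using continuous_imp_measurable_on_sets_lebesgue[OF continuous_on_cutoff, of UNIV] by (simp
          add: lebesgue_on_UNIV_eq)
    with w(1) show ?thesis unfolding k_def[abs_def] by measurable
  qed
  have lim1: "(\<lambda>n. LINT z|?U. h z * p n z) \<longlonglongrightarrow> (LINT z|?U. h z * k z)"
  proof (rule integral_dominated_convergence)
    show "(\<lambda>z. h z * k z) \<in> borel_measurable ?U"
      using h measurable_restrict_space1[OF k_meas] by measurable
    show "(\<lambda>z. h z * p n z) \<in> borel_measurable ?U" for n
      using h continuous_measurable_ball[OF p_cont] by measurable
    show "integrable ?U (\<lambda>z. cmod (h z) * (m + 1))" using h by simp
    show "AE z in ?U. (\<lambda>n. h z * p n z) \<longlonglongrightarrow> h z * k z"
      using AE_N(1) AE_space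
    proof eventually_elim
      case (elim z)
      then have "z \<in> square z\<^sub>0 r" using ball_subset_square[of z\<^sub>0 r] by auto
      then show ?case using p_lim elim by (intro tendsto_intros) auto
    qed
    show "AE z in ?U. norm (h z * p n z) \<le> cmod (h z) * (m + 1)" for n
      using p_bound[OF subsetD[OF ball_subset_square]] by (intro AE_I2) (auto simp: norm_mult
          intro!: mult_left_mono)
  qed
  have lim2: "(\<lambda>n. LINT z|?Q. (cmod (p n z))\<^sup>2) \<longlonglongrightarrow> (LINT z|?Q.
      (cmod (k z))\<^sup>2)"
  proof (rule integral_dominated_convergence)
    show "(\<lambda>z. (cmod (k z))\<^sup>2) \<in> borel_measurable ?Q"
      using measurable_restrict_space1[OF k_meas] by measurable
    show "(\<lambda>z. (cmod (p n z))\<^sup>2) \<in> borel_measurable ?Q" for n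
      by (intro continuous_measurable_square continuous_intros p_cont)
    show "integrable ?Q (\<lambda>z. (m + 1)\<^sup>2)"
      by (intro integrable_continuous_on_square continuous_intros)
    show "AE z in ?Q. (\<lambda>n. (cmod (p n z))\<^sup>2) \<longlonglongrightarrow> (cmod (k z))\<^sup>2"
      using AE_N(2) AE_space by eventually_elim (use p_lim in \<open>auto intro!: tendsto_intros\<close>)
    show "AE z in ?Q. norm ((cmod (p n z))\<^sup>2) \<le> (m + 1)\<^sup>2" for n
      using p_bound by (intro AE_I2) (auto intro!: power_mono)
  qed
  \<comment> \<open>Parseval left an integral over the square; since \<open>w\<close> vanishes off
    the disc, it reduces to the disc in the limit.\<close>
  have "(LINT z|?Q. (cmod (k z))\<^sup>2) = (LINT z|?Q. (if z \<in> ball z\<^sub>0 r then (cmod (k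
      z))\<^sup>2 else 0))"
    using w(3) by (intro Bochner_Integration.integral_cong refl) (simp add: k_def)
  also have "\<dots> = (LINT z|?U. (cmod (k z))\<^sup>2)"
    by (intro Lebesgue_Measure.integral_restrict ball_subset_square) auto
  finally have kQ: "(LINT z|?Q. (cmod (k z))\<^sup>2) = (LINT z|?U. (cmod (k z))\<^sup>2)" .
  have "2 * cmod (LINT z|?U. h z * k z)
    \<le> (4 * r / pi)\<^sup>2 * (LINT z|?U. (cmod (G z))\<^sup>2) + (LINT z|?Q. (cmod (k z))\<^sup>2)"
  proof (rule LIMSEQ_le)
    show "(\<lambda>n. 2 * cmod (LINT z|?U. h z * p n z)) \<longlonglongrightarrow> 2 * cmod (LINT
        z|?U. h z * k z)"
      by (intro tendsto_intros lim1)
    show "(\<lambda>n. (4 * r / pi)\<^sup>2 * (LINT z|?U. (cmod (G z))\<^sup>2) + (LINT z|?Q. (cmod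
        (p n z))\<^sup>2)) \<longlonglongrightarrow>
       (4 * r / pi)\<^sup>2 * (LINT z|?U. (cmod (G z))\<^sup>2) + (LINT z|?Q. (cmod (k z))\<^sup>2)"
      by (intro tendsto_add tendsto_const lim2)
    show "\<exists>n0. \<forall>n\<ge>n0. 2 * cmod (LINT z|?U. h z * p n z) \<le>
       (4 * r / pi)\<^sup>2 * (LINT z|?U. (cmod (G z))\<^sup>2) + (LINT z|?Q. (cmod (p n z))\<^sup>2)"
      using half_wave_sum_pairing[OF r h G rel S] by (auto simp: p_def)
  qed
  then show ?thesis unfolding kQ by (simp only: k_def)
qed

text \<open>Apply \<open>cutoff_pairing\<close> with \<open>w\<close> the conjugate of
  \<open>f\<close>, set to 0 where |f| exceeds \<open>Suc n\<close>. The pairing and the last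
  integral are then both the integral of \<open>T n\<close>, so one copy is absorbed and a bound
  independent of \<open>n\<close> remains; dominated convergence removes the truncation.\<close>

lemma cutoff_L2_bound:
  assumes r: "r > 0" and f: "L2_on (ball z\<^sub>0 r) f" and G: "L2_on (ball z\<^sub>0 r) G"
    and rel: "\<And>i. half_wave_symbol r i * (LINT z|lebesgue_on (ball z\<^sub>0 r). (of_real
        (cutoff z\<^sub>0 r z) * f z) * half_wave r i z)
      = (LINT z|lebesgue_on (ball z\<^sub>0 r). G z * half_wave r i z)"
  shows "(LINT z|lebesgue_on (ball z\<^sub>0 r). (cutoff z\<^sub>0 r z)\<^sup>2 * (cmod (f z))\<^sup>2)
    \<le> (4 * r / pi)\<^sup>2 * (LINT z|lebesgue_on (ball z\<^sub>0 r). (cmod (G z))\<^sup>2)"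
proof -
  let ?U = "lebesgue_on (ball z\<^sub>0 r)"
  define R where "R = (4 * r / pi)\<^sup>2 * (LINT z|?U. (cmod (G z))\<^sup>2)"
  have fm: "f \<in> borel_measurable ?U" and f2: "integrable ?U (\<lambda>z. (cmod (f z))\<^sup>2)"
    using f by (auto simp: L2_on_def)
  have cut_meas: "(\<lambda>z. of_real (cutoff z\<^sub>0 r z) :: complex) \<in> borel_measurable ?U"
    by (intro continuous_measurable_ball continuous_intros continuous_on_cutoff)
  have cut_meas': "cutoff z\<^sub>0 r \<in> borel_measurable ?U"
    by (intro continuous_measurable_ball continuous_on_cutoff)
  have h: "integrable ?U (\<lambda>z. of_real (cutoff z\<^sub>0 r z) * f z)"
    using integrable_mult_bounded[OF L2_on_integrable[OF f] cut_meas, of 1]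
    by (simp add: cutoff_bounds mult.commute)
  define T where "T n z = (if cmod (f z) \<le> real (Suc n) then (cutoff z\<^sub>0 r z)\<^sup>2 *
      (cmod (f z))\<^sup>2 else 0)" for n z
  have T_meas: "T n \<in> borel_measurable ?U" for n
    unfolding T_def[abs_def] using fm cut_meas' by measurable
  have T_le: "(LINT z|?U. T n z) \<le> R" for n
  proof -
    \<comment> \<open>Nothing is known about \<open>f\<close> outside the disc; the extension by 0
      makes \<open>w\<close> Lebesgue measurable on the whole plane.\<close>
    define w where "w z = (if z \<in> ball z\<^sub>0 r then (if cmod (f z) \<le> real (Suc n) then
        cnj (f z) else 0) else 0)" for z
    note [measurable] = fm
    have [measurable]: "(\<lambda>z. cnj (f z)) \<in> borel_measurable ?U"
      by (rule measurable_compose[OF fm borel_measurable_continuous_onI]) (intro continuous_intros)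
    have "(\<lambda>z. if cmod (f z) \<le> real (Suc n) then cnj (f z) else 0) \<in> borel_measurable ?U"
      by measurable
    then have w: "w \<in> borel_measurable lebesgue"
      unfolding w_def[abs_def] by (subst borel_measurable_if) auto
    have "(LINT z|?U. (of_real (cutoff z\<^sub>0 r z) * f z) * (of_real (cutoff z\<^sub>0 r z) * w
        z)) = (LINT z|?U. of_real (T n z))"
      by (intro Bochner_Integration.integral_cong refl)
        (auto simp: w_def T_def complex_norm_square[symmetric] power2_eq_square[of "cutoff _ _ _"])
    also have "\<dots> = of_real (LINT z|?U. T n z)" by (rule integral_complex_of_real)
    finally have 1: "cmod (LINT z|?U. (of_real (cutoff z\<^sub>0 r z) * f z) * (of_real (cutoff
        z\<^sub>0 r z) * w z)) = (LINT z|?U. T n z)"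
      by (simp add: T_def integral_nonneg_AE)
    have 2: "(LINT z|?U. (cmod (of_real (cutoff z\<^sub>0 r z) * w z))\<^sup>2) = (LINT z|?U. T n z)"
      by (intro Bochner_Integration.integral_cong refl)
        (auto simp: w_def T_def norm_mult power_mult_distrib)
    have "2 * (LINT z|?U. T n z) \<le> R + (LINT z|?U. T n z)"
      using cutoff_pairing[OF r h G rel w, of "real (Suc n)"] unfolding 1 2 R_def[symmetric]
      by (auto simp: w_def)
    then show ?thesis by simp
  qed
  have "(\<lambda>n. LINT z|?U. T n z) \<longlonglongrightarrow> (LINT z|?U. (cutoff z\<^sub>0 r
      z)\<^sup>2 * (cmod (f z))\<^sup>2)"
  proof (rule integral_dominated_convergence[OF _ T_meas f2])
    show "(\<lambda>z. (cutoff z\<^sub>0 r z)\<^sup>2 * (cmod (f z))\<^sup>2) \<in> borel_measurable ?U"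
      using fm cut_meas' by measurable
    show "AE z in ?U. (\<lambda>n. T n z) \<longlonglongrightarrow> (cutoff z\<^sub>0 r z)\<^sup>2
        * (cmod (f z))\<^sup>2"
    proof (rule AE_I2)
      fix z
      obtain n0 where "cmod (f z) \<le> real n0" using real_arch_simple by blast
      then have "\<forall>\<^sub>F n in sequentially. T n z = (cutoff z\<^sub>0 r z)\<^sup>2 *
          (cmod (f z))\<^sup>2"
        unfolding eventually_sequentially by (intro exI[of _ n0]) (auto simp: T_def)
      then show "(\<lambda>n. T n z) \<longlonglongrightarrow> (cutoff z\<^sub>0 r z)\<^sup>2 *
          (cmod (f z))\<^sup>2"
        by (rule tendsto_eventually)
    qed
    have "(cutoff z\<^sub>0 r z)\<^sup>2 \<le> 1" for z
      by (intro power_le_one cutoff_bounds)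
    then show "AE z in ?U. norm (T n z) \<le> (cmod (f z))\<^sup>2" for n
      by (intro AE_I2) (auto simp: T_def mult_left_le_one_le)
  qed
  then show ?thesis unfolding R_def[symmetric]
    by (rule LIMSEQ_le_const2) (use T_le in auto)
qed

section \<open>From the cut-off function back to \<open>f\<close>\<close>

lemma annulus_estimate:
  obtains K :: real where "K > 0"
    "\<And>z\<^sub>0 r f g. r > 0 \<Longrightarrow> L2_on (ball z\<^sub>0 r) f \<Longrightarrow>
        has_distributional_dbar (ball z\<^sub>0 r) f g \<Longrightarrow> L2_on (ball z\<^sub>0 r) g
            \<Longrightarrow>
      (LINT z|lebesgue_on (ball z\<^sub>0 r). (cmod (f z))\<^sup>2) \<le>
      K * (r\<^sup>2 * (LINT z|lebesgue_on (ball z\<^sub>0 r). (cmod (g z))\<^sup>2)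
        + (LINT z|lebesgue_on (ball z\<^sub>0 r). indicator (- ball z\<^sub>0 (r / 2)) z * (cmod (f
            z))\<^sup>2))"
proof -
  obtain B :: real where B: "B > 0" and dbar_ex: "\<And>z\<^sub>0 r. r > 0 \<Longrightarrow>
      \<exists>D. continuous_on UNIV D \<and> (\<forall>z. cmod (D z) \<le> B / r) \<and>
       (\<forall>z\<in>ball z\<^sub>0 (r / 2). D z = 0) \<and>
       (\<forall>a b z. dbar (\<lambda>z. of_real (cutoff z\<^sub>0 r z) * wave a b z) z =
         (D z + of_real (cutoff z\<^sub>0 r z) * (\<i> * of_real a - of_real b) / 2) * wave a b z)"
    by (rule dbar_cutoff_wave) blast
  show ?thesis
  proof (rule that)
    \<comment> \<open>The closing computation bounds the norm by 4 r^2 J + (4 B^2 + 1) N; this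
      constant dominates both coefficients.\<close>
    show "4 + 4 * B\<^sup>2 > 0" by (simp add: add_pos_nonneg)
    fix z\<^sub>0 :: complex and r :: real and f g
    assume r: "r > 0" and f: "L2_on (ball z\<^sub>0 r) f" and g: "L2_on (ball z\<^sub>0 r) g"
      and dist: "has_distributional_dbar (ball z\<^sub>0 r) f g"
    let ?U = "lebesgue_on (ball z\<^sub>0 r)" and ?\<chi> = "cutoff z\<^sub>0 r" and ?I =
        "indicator (- ball z\<^sub>0 (r / 2)) :: complex \<Rightarrow> real"
    obtain D where D: "continuous_on UNIV D" "\<And>z. cmod (D z) \<le> B / r" "\<And>z. z \<in>
        ball z\<^sub>0 (r / 2) \<Longrightarrow> D z = 0"
      and dbar: "\<And>a b z. dbar (\<lambda>z. of_real (?\<chi> z) * wave a b z) z =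
         (D z + of_real (?\<chi> z) * (\<i> * of_real a - of_real b) / 2) * wave a b z"
      using dbar_ex[OF r, of z\<^sub>0] by blast
    \<comment> \<open>\<open>G\<close> is minus dbar of the cut-off function; the sign comes from
      moving the derivative onto the half wave.\<close>
    define G where "G z = - (of_real (?\<chi> z) * g z + D z * f z)" for z
    define J where "J = (LINT z|?U. (cmod (g z))\<^sup>2)"
    define N where "N = (LINT z|?U. ?I z * (cmod (f z))\<^sup>2)"
    have fm: "f \<in> borel_measurable ?U" and gm: "g \<in> borel_measurable ?U"
      and f2: "integrable ?U (\<lambda>z. (cmod (f z))\<^sup>2)" and g2: "integrable ?U
          (\<lambda>z. (cmod (g z))\<^sup>2)"
      using f g by (auto simp: L2_on_def)
    have If2: "integrable ?U (\<lambda>z. ?I z * (cmod (f z))\<^sup>2)"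
      by (rule L2_on_integrable_indicator[OF f]) (simp add: Compl_in_sets_lebesgue)
    have \<chi>m: "(\<lambda>z. of_real (?\<chi> z) :: complex) \<in> borel_measurable ?U" and Dm:
        "D \<in> borel_measurable ?U"
      by (intro continuous_measurable_ball continuous_intros continuous_on_cutoff D)+
    have Gm: "G \<in> borel_measurable ?U" unfolding G_def[abs_def] using \<chi>m Dm fm gm by measurable
    \<comment> \<open>Since \<open>D\<close> vanishes on the half disc, \<open>f\<close> contributes
      only on the annulus. The factors 2 come from (a + b)^2 <= 2a^2 + 2b^2.\<close>
    have G_le: "(cmod (G z))\<^sup>2 \<le> 2 * (cmod (g z))\<^sup>2 + 2 * (B / r)\<^sup>2 * (?I z *
        (cmod (f z))\<^sup>2)" for z
    proof -
      have "cmod (G z) \<le> cmod (of_real (?\<chi> z) * g z) + cmod (D z * f z)"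
        unfolding G_def norm_minus_cancel by (rule norm_triangle_ineq)
      moreover have "cmod (of_real (?\<chi> z) * g z) \<le> cmod (g z)"
        using cutoff_bounds[of z\<^sub>0 r z] by (simp add: norm_mult mult_left_le_one_le)
      moreover have "cmod (D z * f z) \<le> (B / r) * (?I z * cmod (f z))"
      proof (cases "z \<in> ball z\<^sub>0 (r / 2)")
        case False
        then show ?thesis using mult_right_mono[OF D(2)[of z] norm_ge_zero[of "f z"]] by (simp add: norm_mult)
      qed (use D(3) in auto)
      ultimately have "cmod (G z) \<le> cmod (g z) + (B / r) * (?I z * cmod (f z))" by linarith
      then have "(cmod (G z))\<^sup>2 \<le> (cmod (g z) + (B / r) * (?I z * cmod (f z)))\<^sup>2"
        by (rule power_mono) simp
      also have "\<dots> \<le> 2 * (cmod (g z))\<^sup>2 + 2 * ((B / r) * (?I z * cmod (f z)))\<^sup>2"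
        using sum_squares_bound[of "cmod (g z)" "(B / r) * (?I z * cmod (f z))"] by (simp add: power2_sum)
      also have "\<dots> = 2 * (cmod (g z))\<^sup>2 + 2 * (B / r)\<^sup>2 * (?I z * (cmod (f z))\<^sup>2)"
        by (simp add: power_mult_distrib power_divide indicator_def)
      finally show ?thesis .
    qed
    have bound_int: "integrable ?U (\<lambda>z. 2 * (cmod (g z))\<^sup>2 + 2 * (B / r)\<^sup>2 *
        (?I z * (cmod (f z))\<^sup>2))"
      using g2 If2 by (intro Bochner_Integration.integrable_add integrable_mult_right) auto
    have G: "L2_on (ball z\<^sub>0 r) G" unfolding L2_on_def
    proof
      show "integrable ?U (\<lambda>z. (cmod (G z))\<^sup>2)"
        by (rule Bochner_Integration.integrable_bound[OF bound_int])
          (use Gm G_le in \<open>auto intro!: AE_I2 order_trans[OF G_le abs_ge_self]\<close>)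
    qed (rule Gm)
    have G_int: "(LINT z|?U. (cmod (G z))\<^sup>2) \<le> 2 * J + 2 * (B / r)\<^sup>2 * N"
    proof -
      have "(LINT z|?U. (cmod (G z))\<^sup>2) \<le> (LINT z|?U. 2 * (cmod (g z))\<^sup>2 + 2 * (B /
          r)\<^sup>2 * (?I z * (cmod (f z))\<^sup>2))"
        using G G_le bound_int by (intro integral_mono) (auto simp: L2_on_def)
      also have "\<dots> = 2 * J + 2 * (B / r)\<^sup>2 * N"
        using g2 If2 by (simp add: J_def N_def)
      finally show ?thesis .
    qed
    \<comment> \<open>The distributional identity is tested with cutoff times wave. The product rule
      yields a multiple of the coefficient of the cut-off function and a term with \<open>D\<close>,
      which joins the term with \<open>g\<close> to form \<open>G\<close>.\<close>
    have rel: "half_wave_symbol r i * (LINT z|?U. (of_real (?\<chi> z) * f z) * half_wave r i z)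
      = (LINT z|?U. G z * half_wave r i z)" for i
    proof -
      obtain a b where w: "half_wave r i = wave a b" and s: "half_wave_symbol r i = (\<i> * of_real
          a - of_real b) / 2"
        by (cases i) (auto simp: half_wave_def half_wave_symbol_def)
      have wm: "wave a b \<in> borel_measurable ?U"
        by (intro continuous_measurable_ball continuous_intros)
      have \<chi>wm: "(\<lambda>z. of_real (?\<chi> z) * wave a b z) \<in> borel_measurable ?U"
        and Dwm: "(\<lambda>z. D z * wave a b z) \<in> borel_measurable ?U"
        using \<chi>m wm Dm by measurable
      have i\<chi>: "integrable ?U (\<lambda>z. F z * (of_real (?\<chi> z) * wave a b z))" if
          "integrable ?U F" for F
        by (rule integrable_mult_bounded[OF that \<chi>wm, of 1]) (simp add: norm_mult cutoff_bounds)
      have iD: "integrable ?U (\<lambda>z. f z * (D z * wave a b z))"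
        by (rule integrable_mult_bounded[OF L2_on_integrable[OF f] Dwm, of "B / r"]) (simp add:
            norm_mult D(2))
      note if\<chi> = i\<chi>[OF L2_on_integrable[OF f]] and ig\<chi> = i\<chi>[OF L2_on_integrable[OF g]]
      have "(LINT z|?U. g z * (of_real (?\<chi> z) * wave a b z)) = - (LINT z|?U. f z * dbar
          (\<lambda>z. of_real (?\<chi> z) * wave a b z) z)"
        using dist test_function_cutoff_wave[OF r, of z\<^sub>0 a b] unfolding
            has_distributional_dbar_def by blast
      also have "(LINT z|?U. f z * dbar (\<lambda>z. of_real (?\<chi> z) * wave a b z) z) =
        (LINT z|?U. f z * (D z * wave a b z) + half_wave_symbol r i * (f z * (of_real (?\<chi> z) *
            wave a b z)))"
        unfolding dbar s by (intro Bochner_Integration.integral_cong refl) (simp add: algebra_simps)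
      also have "\<dots> = (LINT z|?U. f z * (D z * wave a b z)) + half_wave_symbol r i * (LINT
          z|?U. f z * (of_real (?\<chi> z) * wave a b z))"
        using iD if\<chi> by simp
      finally have "half_wave_symbol r i * (LINT z|?U. f z * (of_real (?\<chi> z) * wave a b z)) =
        - (LINT z|?U. g z * (of_real (?\<chi> z) * wave a b z)) - (LINT z|?U. f z * (D z * wave a b z))"
        by simp
      also have "\<dots> = (LINT z|?U. - (g z * (of_real (?\<chi> z) * wave a b z)) - f z * (D z *
          wave a b z))"
        using iD ig\<chi> by simp
      also have "\<dots> = (LINT z|?U. G z * wave a b z)"
        by (intro Bochner_Integration.integral_cong refl) (simp add: G_def algebra_simps)
      finally show ?thesis unfolding w by (simp add: mult_ac)
    qed
    have \<chi>f2: "integrable ?U (\<lambda>z. (?\<chi> z)\<^sup>2 * (cmod (f z))\<^sup>2)"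
    proof (rule Bochner_Integration.integrable_bound[OF f2])
      have "?\<chi> \<in> borel_measurable ?U" by (intro continuous_measurable_ball continuous_on_cutoff)
      then show "(\<lambda>z. (?\<chi> z)\<^sup>2 * (cmod (f z))\<^sup>2) \<in> borel_measurable
          ?U" using fm by measurable
      have "(?\<chi> z)\<^sup>2 \<le> 1" for z by (intro power_le_one cutoff_bounds)
      then show "AE z in ?U. norm ((?\<chi> z)\<^sup>2 * (cmod (f z))\<^sup>2) \<le> norm ((cmod (f
          z))\<^sup>2)"
        by (intro AE_I2) (simp add: mult_left_le_one_le)
    qed
    have JN: "J \<ge> 0" "N \<ge> 0" unfolding J_def N_def by (auto intro!: integral_nonneg_AE AE_I2)
    \<comment> \<open>On the half disc the cutoff is 1, elsewhere the indicator is 1, so the two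
      summands together dominate |f|^2.\<close>
    have "(LINT z|?U. (cmod (f z))\<^sup>2) \<le> (LINT z|?U. (?\<chi> z)\<^sup>2 * (cmod (f
        z))\<^sup>2 + ?I z * (cmod (f z))\<^sup>2)"
    proof (rule integral_mono[OF f2])
      show "integrable ?U (\<lambda>z. (?\<chi> z)\<^sup>2 * (cmod (f z))\<^sup>2 + ?I z * (cmod (f
          z))\<^sup>2)"
        using \<chi>f2 If2 by simp
      show "(cmod (f z))\<^sup>2 \<le> (?\<chi> z)\<^sup>2 * (cmod (f z))\<^sup>2 + ?I z * (cmod (f
          z))\<^sup>2" for z
        using cutoff_eq_1[of z z\<^sub>0 r] by (cases "z \<in> ball z\<^sub>0 (r / 2)") auto
    qed
    also have "\<dots> = (LINT z|?U. (?\<chi> z)\<^sup>2 * (cmod (f z))\<^sup>2) + N"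
      using \<chi>f2 If2 by (simp add: N_def)
    also have "\<dots> \<le> (4 * r / pi)\<^sup>2 * (2 * J + 2 * (B / r)\<^sup>2 * N) + N"
      using order_trans[OF cutoff_L2_bound[OF r f G rel] mult_left_mono[OF G_int]] by simp
    also have "\<dots> \<le> 2 * r\<^sup>2 * (2 * J + 2 * (B / r)\<^sup>2 * N) + N"
    proof -
      \<comment> \<open>From pi > 3 one gets 16/pi^2 < 2, which clears pi from the constant.\<close>
      have "3\<^sup>2 \<le> pi\<^sup>2" using pi_gt3 by (intro power_mono) auto
      then have "2 * r\<^sup>2 * 8 \<le> 2 * r\<^sup>2 * pi\<^sup>2" by (intro mult_left_mono) auto
      then have "(4 * r / pi)\<^sup>2 \<le> 2 * r\<^sup>2" by (simp add: power_divide
          power_mult_distrib pos_divide_le_eq)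
      then show ?thesis using JN by (intro add_right_mono mult_right_mono) auto
    qed
    also have "\<dots> = 4 * (r\<^sup>2 * J) + (4 * B\<^sup>2 + 1) * N"
      using r by (simp add: field_simps)
    also have "\<dots> \<le> (4 + 4 * B\<^sup>2) * (r\<^sup>2 * J) + (4 + 4 * B\<^sup>2) * N"
      using JN mult_right_mono[of 4 "4 + 4 * B\<^sup>2" "r\<^sup>2 * J"]
        mult_right_mono[of "4 * B\<^sup>2 + 1" "4 + 4 * B\<^sup>2" N]
      by simp
    finally show "(LINT z|?U. (cmod (f z))\<^sup>2) \<le> (4 + 4 * B\<^sup>2) *
       (r\<^sup>2 * (LINT z|?U. (cmod (g z))\<^sup>2) + (LINT z|?U. ?I z * (cmod (f z))\<^sup>2))"
      by (simp add: J_def N_def distrib_left)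
  qed
qed

section \<open>Inserting the potential\<close>

theorem lemma12:
  shows "\<exists>\<kappa>::real. \<kappa> > 0 \<and>
    (\<forall>(z\<^sub>0::complex) (r::real) (V::complex \<Rightarrow> real) (f::complex \<Rightarrow> complex) (g::complex \<Rightarrow> complex).
       r > 0 \<longrightarrow>
       V \<in> borel_measurable (lebesgue_on (ball z\<^sub>0 r)) \<longrightarrow>
       (\<forall>z\<in>ball z\<^sub>0 r. 0 \<le> V z) \<longrightarrow>
       L2_on (ball z\<^sub>0 r) f \<longrightarrow>
       has_distributional_dbar (ball z\<^sub>0 r) f g \<longrightarrow>
       L2_on (ball z\<^sub>0 r) g \<longrightarrow>
       (\<integral>\<^sup>+ z. ennreal ((cmod (g z))\<^sup>2) \<partial>lebesgue_on (ball z\<^sub>0 r))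
         + (\<integral>\<^sup>+ z. ennreal (V z * (cmod (f z))\<^sup>2) \<partial>lebesgue_on (ball z\<^sub>0 r))
       \<ge> ennreal (\<kappa> * min (INF z'\<in>ball z\<^sub>0 r - ball z\<^sub>0 (r / 2). V z') (1 / r\<^sup>2))
         * (\<integral>\<^sup>+ z. ennreal ((cmod (f z))\<^sup>2) \<partial>lebesgue_on (ball z\<^sub>0 r)))"
proof -
  obtain K :: real where K: "K > 0"
    and est: "\<And>z\<^sub>0 r f g. r > 0 \<Longrightarrow> L2_on (ball z\<^sub>0 r) f \<Longrightarrow> has_distributional_dbar (ball z\<^sub>0 r) f g \<Longrightarrow> L2_on (ball z\<^sub>0 r) g \<Longrightarrow>
      (LINT z|lebesgue_on (ball z\<^sub>0 r). (cmod (f z))\<^sup>2) \<le>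
      K * (r\<^sup>2 * (LINT z|lebesgue_on (ball z\<^sub>0 r). (cmod (g z))\<^sup>2)
        + (LINT z|lebesgue_on (ball z\<^sub>0 r). indicator (- ball z\<^sub>0 (r / 2)) z * (cmod (f z))\<^sup>2))"
    by (rule annulus_estimate) blast
  show ?thesis
  proof (intro exI[of _ "1 / K"] conjI allI impI)
    show "1 / K > 0" using K by simp
    fix z\<^sub>0 :: complex and r :: real and V :: "complex \<Rightarrow> real" and f g :: "complex \<Rightarrow> complex"
    assume r: "r > 0" and Vm: "V \<in> borel_measurable (lebesgue_on (ball z\<^sub>0 r))"
      and V: "\<forall>z\<in>ball z\<^sub>0 r. 0 \<le> V z" and f: "L2_on (ball z\<^sub>0 r) f"
      and dist: "has_distributional_dbar (ball z\<^sub>0 r) f g" and g: "L2_on (ball z\<^sub>0 r) g"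
    let ?U = "lebesgue_on (ball z\<^sub>0 r)" and ?A = "ball z\<^sub>0 r - ball z\<^sub>0 (r / 2)"
      and ?I = "indicator (- ball z\<^sub>0 (r / 2)) :: complex \<Rightarrow> real"
    define c where "c = (INF z'\<in>?A. V z')"
    define m where "m = min c (1 / r\<^sup>2)"
    define J where "J = (LINT z|?U. (cmod (g z))\<^sup>2)"
    define N where "N = (LINT z|?U. ?I z * (cmod (f z))\<^sup>2)"
    define P where "P = (LINT z|?U. (cmod (f z))\<^sup>2)"
    have fm: "f \<in> borel_measurable ?U"
      and f2: "integrable ?U (\<lambda>z. (cmod (f z))\<^sup>2)" and g2: "integrable ?U (\<lambda>z. (cmod (g z))\<^sup>2)"
      using f g by (auto simp: L2_on_def)
    have If2: "integrable ?U (\<lambda>z. ?I z * (cmod (f z))\<^sup>2)"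
      by (rule L2_on_integrable_indicator[OF f]) (simp add: Compl_in_sets_lebesgue)
    have JN: "J \<ge> 0" "N \<ge> 0" unfolding J_def N_def by (auto intro!: integral_nonneg_AE AE_I2)
    \<comment> \<open>A point at distance exactly r/2 from the centre lies outside the open half
      disc. This makes the annulus nonempty, which the lower bound for the real infimum
      requires.\<close>
    have "z\<^sub>0 + of_real (r / 2) \<in> ?A" using r by (simp add: dist_norm)
    then have c0: "c \<ge> 0" unfolding c_def using V by (intro cINF_greatest) auto
    have c_le: "c \<le> V z" if "z \<in> ?A" for z
      unfolding c_def using V that by (intro cINF_lower bdd_belowI2[of _ 0]) auto
    have m: "m \<ge> 0" "m \<le> c" "m * r\<^sup>2 \<le> 1"
      using c0 r by (auto simp: m_def min_def field_simps)
    have "1 / K * m * P \<le> 1 / K * m * (K * (r\<^sup>2 * J + N))"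
      unfolding P_def J_def N_def using K m by (intro mult_left_mono est[OF r f dist g]) auto
    also have "\<dots> = (m * r\<^sup>2) * J + m * N" using K by (simp add: field_simps)
    \<comment> \<open>The two entries of the minimum are used separately: 1/r^2 absorbs the factor
      r^2 of \<open>J\<close>, and \<open>c\<close> takes care of \<open>N\<close>.\<close>
    also have "\<dots> \<le> 1 * J + c * N" using m JN by (intro add_mono mult_right_mono)
    finally have main: "1 / K * m * P \<le> J + c * N" by simp
    \<comment> \<open>The integrals of |f|^2 and |g|^2 are finite and pass to real numbers. The
      integral with \<open>V\<close> may be infinite, so it stays an extended nonnegative integral
      and is bounded below pointwise.\<close>
    have "ennreal (1 / K * m) * (\<integral>\<^sup>+ z. ennreal ((cmod (f z))\<^sup>2) \<partial>?U) = ennreal (1 / K * m) * ennreal P"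
      unfolding P_def by (subst nn_integral_eq_integral[OF f2]) auto
    also have "\<dots> = ennreal (1 / K * m * P)"
      using K m by (intro ennreal_mult'[symmetric]) auto
    also have "\<dots> \<le> ennreal (J + c * N)" using main by (rule ennreal_leI)
    also have "\<dots> = ennreal J + ennreal (c * N)" using JN c0 by (intro ennreal_plus) auto
    also have "ennreal J = (\<integral>\<^sup>+ z. ennreal ((cmod (g z))\<^sup>2) \<partial>?U)"
      unfolding J_def by (rule nn_integral_eq_integral[OF g2, symmetric]) auto
    also have "ennreal (c * N) = ennreal (LINT z|?U. c * (?I z * (cmod (f z))\<^sup>2))"
      by (simp add: N_def)
    also have "\<dots> = (\<integral>\<^sup>+ z. ennreal (c * (?I z * (cmod (f z))\<^sup>2)) \<partial>?U)"
      using If2 c0 by (intro nn_integral_eq_integral[symmetric]) auto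
    also have "\<dots> \<le> (\<integral>\<^sup>+ z. ennreal (V z * (cmod (f z))\<^sup>2) \<partial>?U)"
    proof (rule nn_integral_mono, rule ennreal_leI)
      \<comment> \<open>On the half disc the left side is 0 and \<open>V\<close> is nonnegative; on
        the annulus \<open>V\<close> is at least its infimum \<open>c\<close>.\<close>
      fix z assume "z \<in> space ?U"
      then have z: "z \<in> ball z\<^sub>0 r" by simp
      show "c * (?I z * (cmod (f z))\<^sup>2) \<le> V z * (cmod (f z))\<^sup>2"
        using z V c_le[of z] by (cases "z \<in> ball z\<^sub>0 (r / 2)") (auto intro!: mult_right_mono)
    qed
    finally show "ennreal (1 / K * min (INF z'\<in>?A. V z') (1 / r\<^sup>2)) * (\<integral>\<^sup>+ z. ennreal ((cmod (f z))\<^sup>2) \<partial>?U)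
      \<le> (\<integral>\<^sup>+ z. ennreal ((cmod (g z))\<^sup>2) \<partial>?U) + (\<integral>\<^sup>+ z. ennreal (V z * (cmod (f z))\<^sup>2) \<partial>?U)"
      unfolding m_def c_def by (simp add: add_left_mono)
  qed
qed

end
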